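(* Fix $z$ with $0<|z|<1$. Let $\mathbf K_z^{(1)}|_{\frac x2,\frac\tau2}$ be the flat-initial-condition operator $\mathbf K_z^{(1)}$ with $(x,\tau)$ replaced by $(\frac x2,\frac\tau2)$. On the open set of $(\tau,x)$, $\tau>0$, $x\in\mathbb R$, where $\det(\mathbf I-\mathbf K_z^{(1)}|_{\frac x2,\frac\tau2})\neq0$, the function $$U(\tau,x)=2\,\partial_{xx}\log\det\left(\mathbf I-\mathbf K_z^{(1)}|_{\frac x2,\frac\tau2}\right)$$ satisfies the KdV equation $$3U_\tau+U_{xxx}+6UU_x=0 .$$
   Context: Roots and logarithms are principal. $\mathrm{Li}_s(z)=\sum_{k\ge1}z^k/k^s$ for $|z|<1$, continued analytically to $\mathbb C\setminus[1,\infty)$. For $0<|z|<1$, $\mathcal S_-=\{\xi\in\mathbb C:e^{-\xi^2/2}=z,\ \mathrm{Re}\,\xi<0\}$, a subset of the sector $3\pi/4<\arg\xi<5\pi/4$; in that sector $Q(\xi)=\sqrt{2/\pi}\int_{-\infty}^\xi\mathrm{Li}_{1/2}(e^{-s^2/2})ds$ (path in the sector) and $\Psi(\xi;x,\tau)=-\frac13\tau\xi^3+x\xi-\frac12Q(\xi)$. $\mathbf K^{(1)}_z$ is the operator on $\ell^2(\mathcal S_-)$ with kernel $$\mathbf K_z^{(1)}(\xi_1,\xi_2)=\frac{e^{\Psi(\xi_1)+\Psi(\xi_2)}}{\xi_1(\xi_1+\xi_2)}$$ (conjugate to the kernel $-\frac{e^{\Psi(\xi_1)+\Psi(\xi_2)}}{\sqrt{-\xi_1}\sqrt{-\xi_2}(\xi_1+\xi_2)}$,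 with the same Fredholm determinant). *)

theory Defs
  imports "HOL-Complex_Analysis.Complex_Analysis" "Jordan_Normal_Form.Determinant"
begin

text \<open>The power series on the unit disc; elsewhere on the slit plane the value of the unique
  holomorphic function on the slit plane that extends it.\<close>

definition polylog :: "complex \<Rightarrow> complex \<Rightarrow> complex" where
  "polylog s z =
     (if norm z < 1 then (\<Sum>k. z ^ Suc k / of_nat (Suc k) powr s)
      else (THE w. \<exists>f. f holomorphic_on (- (complex_of_real ` {1..})) \<and>
                       (\<forall>u\<in>ball 0 1. f u = (\<Sum>k. u ^ Suc k / of_nat (Suc k) powr s)) \<and>
                       w = f z))"

definition S_minus :: "complex \<Rightarrow> complex set" where
  "S_minus z = {\<xi>. exp (- \<xi>\<^sup>2 / 2) = z \<and> Re \<xi> < 0}"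

text \<open>The path from \<open>-\<infinity>\<close> to \<open>\<xi>\<close> is the horizontal ray \<open>s = \<xi> + t\<close>, \<open>t \<le> 0\<close>. For \<open>\<xi>\<close> in the sector
  \<open>3\<pi>/4 < arg \<xi> < 5\<pi>/4\<close>, i.e. \<open>\<bar>Im \<xi>\<bar> < - Re \<xi>\<close>, it stays in the sector. There \<open>Re (s\<^sup>2) > 0\<close>, so
  the integrand is holomorphic and the integral does not depend on the path in the sector.\<close>

definition Qfun :: "complex \<Rightarrow> complex" where
  "Qfun \<xi> = of_real (sqrt (2 / pi)) *
     (LINT t:{..0}|lborel. polylog (1/2) (exp (- (\<xi> + of_real t)\<^sup>2 / 2)))"

definition Psi :: "complex \<Rightarrow> real \<Rightarrow> real \<Rightarrow> complex" where
  "Psi \<xi> x \<tau> = - (1/3) * of_real \<tau> * \<xi> ^ 3 + of_real x * \<xi> - (1/2) * Qfun \<xi>"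

text \<open>The kernel of the flat-initial-condition operator on the square-summable functions on
  \<open>S_minus z\<close>; the dependence on \<open>z\<close> is only through that index set.\<close>

definition K1 :: "real \<Rightarrow> real \<Rightarrow> complex \<Rightarrow> complex \<Rightarrow> complex" where
  "K1 x \<tau> \<xi>1 \<xi>2 = exp (Psi \<xi>1 x \<tau> + Psi \<xi>2 x \<tau>) / (\<xi>1 * (\<xi>1 + \<xi>2))"

text \<open>The Fredholm determinant \<open>det (I - K)\<close> of the operator with kernel \<open>K\<close> on the square-summable
  functions on a discrete set \<open>S\<close>, given by the Fredholm series
  \<open>\<Sum>n. (-1)^n / n! \<Sum>(\<xi>\<^sub>0,\<dots>,\<xi>\<^sub>n\<^sub>-\<^sub>1)\<in>S\<^sup>n. det (K \<xi>\<^sub>i \<xi>\<^sub>j)\<close>.\<close>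

definition fredholm_det :: "'a set \<Rightarrow> ('a \<Rightarrow> 'a \<Rightarrow> complex) \<Rightarrow> complex" where
  "fredholm_det S K =
     (\<Sum>n. (-1) ^ n / fact n *
        (\<Sum>\<^sub>\<infinity>\<xi>\<in>({..<n} \<rightarrow>\<^sub>E S). Determinant.det (Matrix.mat n n (\<lambda>(i, j). K (\<xi> i) (\<xi> j)))))"

definition flat_det :: "complex \<Rightarrow> real \<Rightarrow> real \<Rightarrow> complex" where
  "flat_det z \<tau> x = fredholm_det (S_minus z) (K1 (x / 2) (\<tau> / 2))"

definition flat_domain :: "complex \<Rightarrow> (real \<times> real) set" where
  "flat_domain z = {(\<tau>, x). 0 < \<tau> \<and> flat_det z \<tau> x \<noteq> 0}"

text \<open>The branch of the logarithm that is analytic near \<open>c \<noteq> 0\<close> and has the principal value at \<open>c\<close>.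
  It coincides near \<open>c\<close> with the principal branch unless \<open>c\<close> is a negative real, where the principal
  branch is discontinuous. The determinant is complex and may cross the cut; \<open>\<partial>\<^sub>x\<^sub>x log det\<close> is
  understood with a local continuous branch, and does not depend on which.\<close>

definition log_near :: "complex \<Rightarrow> complex \<Rightarrow> complex" where
  "log_near c w = Ln c + Ln (w / c)"

definition second_derivative :: "(real \<Rightarrow> complex) \<Rightarrow> real \<Rightarrow> complex" where
  "second_derivative f x = vector_derivative (\<lambda>y. vector_derivative f (at y)) (at x)"

definition twice_differentiable_at :: "(real \<Rightarrow> complex) \<Rightarrow> real \<Rightarrow> bool" where
  "twice_differentiable_at f x \<longleftrightarrow>
     (\<forall>\<^sub>F y in nhds x. f differentiable (at y)) \<and>
     (\<lambda>y. vector_derivative f (at y)) differentiable (at x)"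

definition log_flat_det_near :: "complex \<Rightarrow> real \<Rightarrow> real \<Rightarrow> real \<Rightarrow> complex" where
  "log_flat_det_near z \<tau> x y = log_near (flat_det z \<tau> x) (flat_det z \<tau> y)"

definition U_flat :: "complex \<Rightarrow> real \<Rightarrow> real \<Rightarrow> complex" where
  "U_flat z \<tau> x = 2 * second_derivative (log_flat_det_near z \<tau> x) x"

end

(* Let S = S_minus z. Cauchy's determinant turns the Fredholm series into a sum over the finite
   subsets A of S,
     f(tau, x) = sum_A W(A) prod_{q in A} c_q exp(x q - tau q^3 / 3),
   where W(A) is the product of ((q - r) / (q + r))^2 over the unordered pairs {q, r} in A: an
   infinite-soliton tau function of KdV. As S lies in a sector of opening pi / 2, |W(A)| <= 1, so the
   sum and all its derivatives are dominated by the product of 1 + |c_q exp(x q - tau q^3 / 3)|, which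
   converges because Re(q^3) grows like |q|^3 on S.

   Hirota's bilinear equation for f reduces, by grouping the pairs (A, B) according to their
   intersection and their symmetric difference D, to one identity for each finite D. That identity is
   proved by induction on D: viewed as a polynomial in one of the points, its left-hand side is even,
   has degree at most 2 |D| - 2, and vanishes at 0 and at plus or minus each other point. KdV is the
   x-derivative of Hirota's equation divided by f^2. *)
theory Submission
  imports Defs "HOL-Probability.Distributions"
begin

text \<open>Hirota's operator is here D_x^4 + 3 D_x D_tau. As tau enters the exponents through
  -q^3/3, its symbol on a pair (A, B) is s_1^4 - s_1 s_3, where s_n is the n-th power sum over A
  minus that over B. The algebra is decided by the degree bound. With m remaining points the
  polynomial has apparent degree 2m + 3, while only 2m + 1 distinct roots are known. The coefficient
  at 2m + 2 cancels in every summand, and evenness removes the odd ones, which leaves degree at most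
  2m. The analytic obstacle is to differentiate a sum over infinitely many subsets repeatedly.
  Convergence is therefore stated with an exponential margin, a fraction of which pays for each
  derivative. Cubic decay on S provides the margin; Q contributes a bounded factor to c_q. The
  determinant is complex, so its logarithm has no evident global branch. U is identified on the
  whole open domain with a rational expression in the derivatives of f, and KdV is proved for that
  expression.\<close>

section \<open>The Cauchy determinant\<close>

text \<open>One step of Gaussian elimination. It drives the induction for the Cauchy determinant,
  because the Schur complement of a Cauchy matrix is again a Cauchy matrix up to scaling of rows and
  columns.\<close>

lemma det_Schur_complement:
  fixes a :: "nat \<Rightarrow> nat \<Rightarrow> 'a :: field"
  assumes "a 0 0 \<noteq> 0"
  shows "Determinant.det (Matrix.mat (Suc n) (Suc n) (\<lambda>(i, j). a i j)) =
    a 0 0 * Determinant.det (Matrix.mat n n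
      (\<lambda>(i, j). a (Suc i) (Suc j) - a (Suc i) 0 * a 0 (Suc j) / a 0 0))"
proof -
  define L where "L = Matrix.mat (Suc n) (Suc n)
    (\<lambda>(i, j). if i = j then 1 else if j = 0 then a i 0 / a 0 0 else 0)"
  define B where "B = Matrix.mat (Suc n) (Suc n)
    (\<lambda>(i, j). if i = 0 then a 0 j else if j = 0 then 0 else a i j - a i 0 * a 0 j / a 0 0)"
  have carr: "L \<in> carrier_mat (Suc n) (Suc n)" "B \<in> carrier_mat (Suc n) (Suc n)"
    by (simp_all add: L_def B_def)
  have "Matrix.mat (Suc n) (Suc n) (\<lambda>(i, j). a i j) = L * B"
  proof (rule eq_matI)
    fix i j assume "i < dim_row (L * B)" "j < dim_col (L * B)"
    then have ij: "i < Suc n" "j < Suc n" by (auto simp: L_def B_def)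
    have "(L * B) $$ (i, j) = (\<Sum>k<Suc n. L $$ (i, k) * B $$ (k, j))"
      using ij carr by (auto simp: scalar_prod_def atLeast0LessThan intro!: sum.cong)
    also have "\<dots> = (\<Sum>k\<in>{0, i}. L $$ (i, k) * B $$ (k, j))"
      using ij by (intro sum.mono_neutral_right) (auto simp: L_def)
    also have "\<dots> = a i j"
      using ij assms by (cases "i = 0") (auto simp: L_def B_def field_simps)
    finally show "Matrix.mat (Suc n) (Suc n) (\<lambda>(i, j). a i j) $$ (i, j) = (L * B) $$ (i, j)"
      using ij by simp
  qed (auto simp: L_def B_def)
  moreover have "Determinant.det L = 1"
  proof -
    have "Determinant.det L = prod_list (diag_mat L)"
      by (rule det_lower_triangular[OF _ carr(1)]) (auto simp: L_def)
    also have "diag_mat L = map (\<lambda>_. 1) [0..<Suc n]"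
      unfolding diag_mat_def by (intro map_cong) (auto simp: L_def)
    finally show ?thesis by (simp only: map_replicate_const prod_list_replicate power_one)
  qed
  moreover have "Determinant.det B = a 0 0 * Determinant.det (mat_delete B 0 0)"
  proof -
    have "Determinant.det B = (\<Sum>i<Suc n. B $$ (i, 0) * cofactor B i 0)"
      by (rule laplace_expansion_column[OF carr(2)]) simp
    also have "\<dots> = (\<Sum>i\<in>{0}. B $$ (i, 0) * cofactor B i 0)"
      by (rule sum.mono_neutral_right) (auto simp: B_def)
    finally show ?thesis by (simp add: cofactor_def B_def)
  qed
  moreover have "mat_delete B 0 0 = Matrix.mat n n
      (\<lambda>(i, j). a (Suc i) (Suc j) - a (Suc i) 0 * a 0 (Suc j) / a 0 0)"
    by (rule eq_matI) (auto simp: mat_delete_def B_def)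
  ultimately show ?thesis
    by (simp add: det_mult[OF carr])
qed

lemma det_scale_rows_cols:
  fixes a :: "nat \<Rightarrow> nat \<Rightarrow> 'a :: comm_ring_1"
  shows "Determinant.det (Matrix.mat n n (\<lambda>(i, j). d i * e j * a i j)) =
    (\<Prod>i<n. d i * e i) * Determinant.det (Matrix.mat n n (\<lambda>(i, j). a i j))"
proof -
  have perm: "(\<Prod>i<n. Matrix.mat n n (\<lambda>(i, j). d i * e j * a i j) $$ (i, p i)) =
      (\<Prod>i<n. d i * e i) * (\<Prod>i<n. Matrix.mat n n (\<lambda>(i, j). a i j) $$ (i, p i))"
    if p: "p permutes {..<n}" for p
  proof -
    have "p i < n" if "i < n" for i
      using permutes_in_image[OF p, of i] that by simp
    then have "(\<Prod>i<n. Matrix.mat n n (\<lambda>(i, j). d i * e j * a i j) $$ (i, p i)) =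
        (\<Prod>i<n. d i) * (\<Prod>i<n. e (p i)) * (\<Prod>i<n. Matrix.mat n n (\<lambda>(i, j). a i j) $$ (i, p i))"
      unfolding prod.distrib[symmetric] by (intro prod.cong) auto
    then show ?thesis
      using prod.permute[OF p, of e] by (simp add: prod.distrib o_def)
  qed
  show ?thesis
    unfolding det_def'[OF mat_carrier] sum_distrib_left atLeast0LessThan
    by (intro sum.cong refl) (simp only: mem_Collect_eq perm, simp only: mult_ac)
qed

text \<open>The factor \<open>\<i>\<close> makes the two ordered pairs from \<open>{q, r}\<close> contribute
  \<open>((q - r) / (q + r))\<^sup>2\<close> together.\<close>
definition soliton_weight :: "complex set \<Rightarrow> complex" where
  "soliton_weight A = (\<Prod>q\<in>A. \<Prod>r\<in>A - {q}. \<i> * (q - r) / (q + r))"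

lemma soliton_weight_empty [simp]: "soliton_weight {} = 1"
  by (simp add: soliton_weight_def)

lemma soliton_weight_insert:
  assumes "finite A" "a \<notin> A"
  shows "soliton_weight (insert a A) = soliton_weight A * (\<Prod>r\<in>A. ((a - r) / (a + r))\<^sup>2)"
proof -
  have "(\<Prod>r\<in>insert a A - {q}. \<i> * (q - r) / (q + r)) =
      \<i> * (q - a) / (q + a) * (\<Prod>r\<in>A - {q}. \<i> * (q - r) / (q + r))" if "q \<in> A" for q
  proof -
    have "insert a A - {q} = insert a (A - {q})" using assms that by auto
    then show ?thesis using assms by simp
  qed
  then have "(\<Prod>q\<in>A. \<Prod>r\<in>insert a A - {q}. \<i> * (q - r) / (q + r)) =
      (\<Prod>q\<in>A. \<i> * (q - a) / (q + a)) * soliton_weight A"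
    unfolding soliton_weight_def prod.distrib[symmetric] by (rule prod.cong[OF refl])
  then have "soliton_weight (insert a A) = (\<Prod>r\<in>A. \<i> * (a - r) / (a + r)) *
      ((\<Prod>q\<in>A. \<i> * (q - a) / (q + a)) * soliton_weight A)"
    using assms by (simp add: soliton_weight_def[of "insert a A"])
  also have "\<dots> = soliton_weight A * (\<Prod>r\<in>A. (\<i> * (a - r) / (a + r)) * (\<i> * (r - a) / (r + a)))"
    by (simp only: prod.distrib mult_ac)
  also have "(\<lambda>r. (\<i> * (a - r) / (a + r)) * (\<i> * (r - a) / (r + a))) = (\<lambda>r. ((a - r) / (a + r))\<^sup>2)"
    by (auto simp: fun_eq_iff power2_eq_square add.commute algebra_simps
      simp flip: minus_divide_left)
  finally show ?thesis .
qed

lemma soliton_weight_Un: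
  assumes "finite A" "finite B" "A \<inter> B = {}"
  shows "soliton_weight (A \<union> B) =
    soliton_weight A * soliton_weight B * (\<Prod>a\<in>A. \<Prod>b\<in>B. ((a - b) / (a + b))\<^sup>2)"
  using assms(1,3)
proof (induction A rule: finite_induct)
  case (insert a A)
  have "(\<Prod>r\<in>A \<union> B. ((a - r) / (a + r))\<^sup>2) =
      (\<Prod>r\<in>A. ((a - r) / (a + r))\<^sup>2) * (\<Prod>r\<in>B. ((a - r) / (a + r))\<^sup>2)"
    using insert assms by (intro prod.union_disjoint) auto
  then show ?case
    using insert assms by (simp add: soliton_weight_insert)
qed simp

text \<open>Eliminating the point z = \<open>p 0\<close> rests on 1/(x+y) - 2z/((x+z)(z+y)) =
  (z-x)(z-y)/((z+x)(z+y)(x+y)). Rows and columns are scaled by the same factors, so the determinant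
  acquires exactly the squares that appear in \<open>soliton_weight_insert\<close>.\<close>

lemma det_symmetric_Cauchy:
  fixes p :: "nat \<Rightarrow> complex"
  assumes "inj_on p {..<n}" "\<And>i j. i < n \<Longrightarrow> j < n \<Longrightarrow> p i + p j \<noteq> 0"
  shows "Determinant.det (Matrix.mat n n (\<lambda>(i, j). 1 / (p i + p j))) =
    soliton_weight (p ` {..<n}) * (\<Prod>i<n. 1 / (2 * p i))"
  using assms
proof (induction n arbitrary: p)
  case (Suc n)
  let ?q = "\<lambda>i. p (Suc i)"
  have p0: "p 0 \<noteq> 0" using Suc.prems(2)[of 0 0] by auto
  have "Determinant.det (Matrix.mat (Suc n) (Suc n) (\<lambda>(i, j). 1 / (p i + p j))) =
      1 / (p 0 + p 0) * Determinant.det (Matrix.mat n n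
      (\<lambda>(i, j). 1 / (?q i + ?q j) - 1 / (?q i + p 0) * (1 / (p 0 + ?q j)) / (1 / (p 0 + p 0))))"
    by (rule det_Schur_complement) (use p0 in simp)
  also have "Matrix.mat n n
      (\<lambda>(i, j). 1 / (?q i + ?q j) - 1 / (?q i + p 0) * (1 / (p 0 + ?q j)) / (1 / (p 0 + p 0))) =
    Matrix.mat n n (\<lambda>(i, j). ((p 0 - ?q i) / (p 0 + ?q i)) * ((p 0 - ?q j) / (p 0 + ?q j)) *
      (1 / (?q i + ?q j)))"
  proof (rule eq_matI, goal_cases)
    case (1 i j)
    then have "?q i + ?q j \<noteq> 0" "?q i + p 0 \<noteq> 0" "p 0 + ?q i \<noteq> 0" "p 0 + ?q j \<noteq> 0"
      using Suc.prems(2)[of "Suc i" "Suc j"] Suc.prems(2)[of "Suc i" 0] Suc.prems(2)[of 0 "Suc j"]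
        Suc.prems(2)[of 0 "Suc i"] by auto
    moreover have "1 / (x + y) - 1 / (x + z) * (1 / (z + y)) / (1 / (z + z)) =
        ((z - x) / (z + x)) * ((z - y) / (z + y)) * (1 / (x + y))"
      if "x + y \<noteq> 0" "x + z \<noteq> 0" "z + x \<noteq> 0" "z + y \<noteq> 0" for x y z :: complex
      using that by (simp add: divide_simps) (simp add: algebra_simps)
    ultimately show ?case using 1 by simp
  qed simp_all
  also have "Determinant.det \<dots> = (\<Prod>i<n. ((p 0 - ?q i) / (p 0 + ?q i)) * ((p 0 - ?q i) / (p 0 + ?q i))) *
      (soliton_weight (?q ` {..<n}) * (\<Prod>i<n. 1 / (2 * ?q i)))"
    using Suc.prems by (subst det_scale_rows_cols, subst Suc.IH) (auto simp: inj_on_def)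
  also have "(\<Prod>i<n. ((p 0 - ?q i) / (p 0 + ?q i)) * ((p 0 - ?q i) / (p 0 + ?q i))) =
      (\<Prod>r\<in>?q ` {..<n}. ((p 0 - r) / (p 0 + r))\<^sup>2)"
    using Suc.prems(1) by (subst prod.reindex) (auto simp: inj_on_def power2_eq_square)
  also have "1 / (p 0 + p 0) * ((\<Prod>r\<in>?q ` {..<n}. ((p 0 - r) / (p 0 + r))\<^sup>2) *
      (soliton_weight (?q ` {..<n}) * (\<Prod>i<n. 1 / (2 * ?q i)))) =
      soliton_weight (insert (p 0) (?q ` {..<n})) * (\<Prod>i<Suc n. 1 / (2 * p i))"
  proof -
    have "p 0 \<notin> ?q ` {..<n}" using Suc.prems(1) by (auto simp: inj_on_def)
    then show ?thesis
      by (subst soliton_weight_insert) (simp_all add: prod.lessThan_Suc_shift del: prod.lessThan_Suc)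
  qed
  also have "insert (p 0) (?q ` {..<n}) = p ` {..<Suc n}"
    by (auto simp: lessThan_Suc_eq_insert_0 image_iff)
  finally show ?case .
qed simp

section \<open>The bilinear identity for finitely many points\<close>

text \<open>Hirota derivatives act on the product of the exponentials of \<open>A\<close> and
  \<open>B\<close> through the difference of their exponents: \<open>signed_sum 1\<close> is the
  symbol of D_x, and \<open>signed_sum 3\<close> that of -3 D_tau.\<close>

definition signed_sum :: "nat \<Rightarrow> complex set \<Rightarrow> complex set \<Rightarrow> complex" where
  "signed_sum n A B = (\<Sum>q\<in>A. q ^ n) - (\<Sum>q\<in>B. q ^ n)"

text \<open>The coefficient that Hirota's equation assigns to the product of the exponentials of the
  points in \<open>D\<close>: the contributing disjoint pairs are the ordered splittings of
  \<open>D\<close>.\<close>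

definition hirota_sum :: "complex set \<Rightarrow> complex" where
  "hirota_sum D = (\<Sum>A\<in>Pow D. soliton_weight A * soliton_weight (D - A) *
     (signed_sum 1 A (D - A) ^ 4 - signed_sum 1 A (D - A) * signed_sum 3 A (D - A)))"

text \<open>Half of \<open>hirota_sum (insert x D)\<close> as a function of the new point x, after
  clearing the denominators (x+r)^2. Here x has joined \<open>A\<close>, so a point r contributes
  (x-r)^2 if it is in \<open>A\<close> and (x+r)^2 if it is on the other side.\<close>

definition hirota_poly :: "complex set \<Rightarrow> complex poly" where
  "hirota_poly D = (\<Sum>A\<in>Pow D. Polynomial.smult (soliton_weight A * soliton_weight (D - A))
     (([:signed_sum 1 A (D - A), 1:] ^ 4 -
         [:signed_sum 1 A (D - A), 1:] * [:signed_sum 3 A (D - A), 0, 0, 1:]) *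
      (\<Prod>r\<in>D. [:if r \<in> A then - r else r, 1:]\<^sup>2)))"

lemma sum_Pow_complement:
  "(\<Sum>A\<in>Pow D. f (D - A) A) = (\<Sum>A\<in>Pow D. f A (D - A))"
  by (rule sum.reindex_bij_witness[of _ "\<lambda>A. D - A" "\<lambda>A. D - A"]) (auto simp: double_diff)

lemma signed_sum_swap: "signed_sum n B A = - signed_sum n A B"
  by (simp add: signed_sum_def)

lemma signed_sum_insert_left:
  "finite A \<Longrightarrow> a \<notin> A \<Longrightarrow> signed_sum n (insert a A) B = a ^ n + signed_sum n A B"
  by (simp add: signed_sum_def)

lemma signed_sum_insert_right:
  "finite B \<Longrightarrow> a \<notin> B \<Longrightarrow> signed_sum n A (insert a B) = signed_sum n A B - a ^ n"
  by (simp add: signed_sum_def)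

lemma poly_hirota_poly:
  "poly (hirota_poly D) x = (\<Sum>A\<in>Pow D. soliton_weight A * soliton_weight (D - A) *
     (((x + signed_sum 1 A (D - A)) ^ 4 -
         (x + signed_sum 1 A (D - A)) * (x ^ 3 + signed_sum 3 A (D - A))) *
      (\<Prod>r\<in>D. (if r \<in> A then x - r else x + r)\<^sup>2)))"
  unfolding hirota_poly_def poly_sum poly_smult poly_mult poly_diff poly_power poly_prod
  by (intro sum.cong arg_cong2[of _ _ _ _ "(*)"] arg_cong2[of _ _ _ _ "(-)"] prod.cong)
     (auto simp: power3_eq_cube algebra_simps)

text \<open>Exchanging \<open>A\<close> with \<open>D - A\<close> negates both signed sums and
  interchanges (x-r)^2 with (x+r)^2. Together with x replaced by -x this leaves each summand
  unchanged, the bracket being invariant when both its odd ingredients change sign.\<close>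

lemma poly_hirota_poly_minus: "poly (hirota_poly D) (- x) = poly (hirota_poly D) x"
proof -
  have "poly (hirota_poly D) (- x) = (\<Sum>A\<in>Pow D. soliton_weight (D - A) * soliton_weight A *
     (((- x + signed_sum 1 (D - A) A) ^ 4 -
         (- x + signed_sum 1 (D - A) A) * ((- x) ^ 3 + signed_sum 3 (D - A) A)) *
      (\<Prod>r\<in>D. (if r \<in> D - A then - x - r else - x + r)\<^sup>2)))"
    unfolding poly_hirota_poly by (subst sum_Pow_complement[symmetric])
      (auto simp: double_diff intro!: sum.cong)
  also have "\<dots> = poly (hirota_poly D) x"
    unfolding poly_hirota_poly
  proof (rule sum.cong[OF refl])
    fix A assume "A \<in> Pow D"
    have sq: "(- x - r)\<^sup>2 = (x + r)\<^sup>2" "(- x + r)\<^sup>2 = (x - r)\<^sup>2" for r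
      by (simp_all add: power2_eq_square algebra_simps)
    have prods: "(\<Prod>r\<in>D. (if r \<in> D - A then - x - r else - x + r)\<^sup>2) =
        (\<Prod>r\<in>D. (if r \<in> A then x - r else x + r)\<^sup>2)"
      by (rule prod.cong) (auto simp: sq power2_commute add.commute)
    have quart: "(- x + - s) ^ 4 - (- x + - s) * ((- x) ^ 3 + - k) =
        (x + s) ^ 4 - (x + s) * (x ^ 3 + k)" for s k :: complex
      by (simp add: power4_eq_xxxx power3_eq_cube algebra_simps)
    show "soliton_weight (D - A) * soliton_weight A *
     (((- x + signed_sum 1 (D - A) A) ^ 4 -
         (- x + signed_sum 1 (D - A) A) * ((- x) ^ 3 + signed_sum 3 (D - A) A)) *
      (\<Prod>r\<in>D. (if r \<in> D - A then - x - r else - x + r)\<^sup>2)) =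
     soliton_weight A * soliton_weight (D - A) *
     (((x + signed_sum 1 A (D - A)) ^ 4 -
         (x + signed_sum 1 A (D - A)) * (x ^ 3 + signed_sum 3 A (D - A))) *
      (\<Prod>r\<in>D. (if r \<in> A then x - r else x + r)\<^sup>2))"
      unfolding signed_sum_swap[of _ "D - A" A] prods quart by (simp only: mult.commute)
  qed
  finally show ?thesis .
qed

text \<open>The splittings with \<open>a\<close> in the first part and those with \<open>a\<close>
  in the second correspond under complementation, and the summand is symmetric. Hence the factor
  2.\<close>

lemma hirota_sum_insert:
  assumes "finite D" "a \<notin> D" "\<And>r. r \<in> D \<Longrightarrow> a + r \<noteq> 0"
  shows "hirota_sum (insert a D) * (\<Prod>r\<in>D. (a + r)\<^sup>2) = 2 * poly (hirota_poly D) a"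
proof -
  define h where "h A B = soliton_weight A * soliton_weight B *
     (signed_sum 1 A B ^ 4 - signed_sum 1 A B * signed_sum 3 A B)" for A B
  have h_sym: "h A B = h B A" for A B
    by (simp add: h_def signed_sum_swap[of _ B A] mult.commute)
  have "hirota_sum (insert a D) = (\<Sum>A\<in>Pow (insert a D). h A (insert a D - A))"
    by (simp add: hirota_sum_def h_def)
  also have "\<dots> = (\<Sum>A\<in>Pow D. h A (insert a D - A)) + (\<Sum>A\<in>insert a ` Pow D. h A (insert a D - A))"
    unfolding Pow_insert using assms by (intro sum.union_disjoint) auto
  also have "(\<Sum>A\<in>insert a ` Pow D. h A (insert a D - A)) = (\<Sum>A\<in>Pow D. h (insert a A) (D - A))"
  proof (subst sum.reindex)
    show "inj_on (insert a) (Pow D)"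
      using assms(2) by (intro inj_onI) (metis PowD insert_ident subsetD)
  qed (use assms in \<open>auto intro!: sum.cong arg_cong2[of _ _ _ _ h]\<close>)
  also have "(\<Sum>A\<in>Pow D. h A (insert a D - A)) = (\<Sum>A\<in>Pow D. h (insert a (D - A)) A)"
    using assms by (intro sum.cong) (auto simp: h_sym intro!: arg_cong2[of _ _ _ _ h])
  also have "\<dots> = (\<Sum>A\<in>Pow D. h (insert a A) (D - A))"
    by (rule sum_Pow_complement)
  finally have *: "hirota_sum (insert a D) = 2 * (\<Sum>A\<in>Pow D. h (insert a A) (D - A))"
    by simp
  have summand: "h (insert a A) (D - A) * (\<Prod>r\<in>D. (a + r)\<^sup>2) = soliton_weight A * soliton_weight (D - A) *
     (((a + signed_sum 1 A (D - A)) ^ 4 -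
         (a + signed_sum 1 A (D - A)) * (a ^ 3 + signed_sum 3 A (D - A))) *
      (\<Prod>r\<in>D. (if r \<in> A then a - r else a + r)\<^sup>2))" if "A \<in> Pow D" for A
  proof -
    have A: "finite A" "a \<notin> A" "A \<subseteq> D" using that assms finite_subset by auto
    have "(\<Prod>r\<in>A. ((a - r) / (a + r))\<^sup>2) = (\<Prod>r\<in>D. if r \<in> A then ((a - r) / (a + r))\<^sup>2 else 1)"
      using A assms by (subst prod.inter_restrict[symmetric]) (auto intro!: prod.cong)
    then have "(\<Prod>r\<in>A. ((a - r) / (a + r))\<^sup>2) * (\<Prod>r\<in>D. (a + r)\<^sup>2) =
        (\<Prod>r\<in>D. (if r \<in> A then a - r else a + r)\<^sup>2)"
      unfolding prod.distrib[symmetric]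
      using assms by (auto simp: prod.distrib[symmetric] power_divide intro!: prod.cong)
    then show ?thesis
      using A by (simp add: h_def soliton_weight_insert signed_sum_insert_left)
  qed
  have "(\<Sum>A\<in>Pow D. h (insert a A) (D - A)) * (\<Prod>r\<in>D. (a + r)\<^sup>2) = poly (hirota_poly D) a"
    unfolding poly_hirota_poly sum_distrib_right by (intro sum.cong refl summand)
  then show ?thesis
    unfolding * by (simp only: mult.assoc)
qed

lemma poly_hirota_poly_0: "poly (hirota_poly D) 0 = hirota_sum D * (\<Prod>r\<in>D. r\<^sup>2)"
  unfolding poly_hirota_poly hirota_sum_def
  by (auto simp: sum_distrib_right intro!: sum.cong prod.cong)

text \<open>At x = \<open>a\<close> the factor (x-a)^2 kills every \<open>A\<close> that contains
  \<open>a\<close>. In the surviving terms \<open>a\<close> sits opposite to x, so the two cancel in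
  both signed sums, and (a+a)^2 gives \<open>4 * a\<^sup>2\<close>. What remains is the sum for
  \<open>D\<close> without \<open>a\<close>.\<close>

lemma poly_hirota_poly_root:
  assumes "finite D" "a \<in> D" "\<And>r. r \<in> D \<Longrightarrow> a + r \<noteq> 0"
  shows "poly (hirota_poly D) a = hirota_sum (D - {a}) * (4 * a\<^sup>2) * (\<Prod>r\<in>D - {a}. (a - r)\<^sup>2)"
proof -
  define E where "E = D - {a}"
  have D: "D = insert a E" and E: "a \<notin> E" "finite E" using assms by (auto simp: E_def)
  have "poly (hirota_poly D) a = (\<Sum>A\<in>Pow E. soliton_weight A * soliton_weight (D - A) *
     (((a + signed_sum 1 A (D - A)) ^ 4 -
         (a + signed_sum 1 A (D - A)) * (a ^ 3 + signed_sum 3 A (D - A))) *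
      (\<Prod>r\<in>D. (if r \<in> A then a - r else a + r)\<^sup>2)))"
    unfolding poly_hirota_poly
  proof (rule sum.mono_neutral_right)
    show "\<forall>A\<in>Pow D - Pow E. soliton_weight A * soliton_weight (D - A) *
     (((a + signed_sum 1 A (D - A)) ^ 4 -
         (a + signed_sum 1 A (D - A)) * (a ^ 3 + signed_sum 3 A (D - A))) *
      (\<Prod>r\<in>D. (if r \<in> A then a - r else a + r)\<^sup>2)) = 0"
    proof
      fix A assume "A \<in> Pow D - Pow E"
      then have "a \<in> A" by (auto simp: D)
      then have "(\<Prod>r\<in>D. (if r \<in> A then a - r else a + r)\<^sup>2) = 0"
        using assms by (intro prod_zero) auto
      then show "soliton_weight A * soliton_weight (D - A) *
     (((a + signed_sum 1 A (D - A)) ^ 4 -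
         (a + signed_sum 1 A (D - A)) * (a ^ 3 + signed_sum 3 A (D - A))) *
      (\<Prod>r\<in>D. (if r \<in> A then a - r else a + r)\<^sup>2)) = 0" by simp
    qed
  qed (use assms in \<open>auto simp: D\<close>)
  also have "\<dots> = (\<Sum>A\<in>Pow E. soliton_weight A * soliton_weight (E - A) *
     (signed_sum 1 A (E - A) ^ 4 - signed_sum 1 A (E - A) * signed_sum 3 A (E - A)) *
     ((4 * a\<^sup>2) * (\<Prod>r\<in>E. (a - r)\<^sup>2)))"
  proof (rule sum.cong[OF refl])
    fix A assume "A \<in> Pow E"
    then have A: "A \<subseteq> E" "a \<notin> A" using E by auto
    have DA: "D - A = insert a (E - A)" using A by (auto simp: D)
    have "(\<Prod>r\<in>E - A. ((a - r) / (a + r))\<^sup>2) = (\<Prod>r\<in>E. if r \<in> A then 1 else ((a - r) / (a + r))\<^sup>2)"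
      using E A by (auto simp: prod.If_cases Diff_eq)
    then have "(\<Prod>r\<in>E - A. ((a - r) / (a + r))\<^sup>2) * (\<Prod>r\<in>E. (if r \<in> A then a - r else a + r)\<^sup>2) =
        (\<Prod>r\<in>E. (a - r)\<^sup>2)"
      using assms(3) by (auto simp: prod.distrib[symmetric] power_divide D intro!: prod.cong)
    moreover have "(\<Prod>r\<in>D. (if r \<in> A then a - r else a + r)\<^sup>2) =
        4 * a\<^sup>2 * (\<Prod>r\<in>E. (if r \<in> A then a - r else a + r)\<^sup>2)"
      using A E by (simp add: D power2_eq_square)
    ultimately show "soliton_weight A * soliton_weight (D - A) *
     (((a + signed_sum 1 A (D - A)) ^ 4 -
         (a + signed_sum 1 A (D - A)) * (a ^ 3 + signed_sum 3 A (D - A))) *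
      (\<Prod>r\<in>D. (if r \<in> A then a - r else a + r)\<^sup>2)) =
      soliton_weight A * soliton_weight (E - A) *
     (signed_sum 1 A (E - A) ^ 4 - signed_sum 1 A (E - A) * signed_sum 3 A (E - A)) *
     ((4 * a\<^sup>2) * (\<Prod>r\<in>E. (a - r)\<^sup>2))"
      using E unfolding DA by (simp add: soliton_weight_insert signed_sum_insert_right)
  qed
  also have "\<dots> = hirota_sum E * (4 * a\<^sup>2) * (\<Prod>r\<in>E. (a - r)\<^sup>2)"
    by (simp add: hirota_sum_def sum_distrib_right mult.assoc)
  finally show ?thesis by (simp add: E_def)
qed

text \<open>Only the two leading coefficients of the product are needed. The extra factor x^2 keeps
  the exponents clear of truncated subtraction when \<open>D\<close> is empty, and it is the x^2
  that is split off the bracket when this is applied.\<close>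

lemma prod_linear_squared_expansion:
  fixes e :: "'a \<Rightarrow> complex"
  assumes "finite D"
  shows "\<exists>g. degree g \<le> 2 * card D \<and> [:0, 0, 1:] * (\<Prod>r\<in>D. [:- e r, 1:]\<^sup>2) =
    Polynomial.monom 1 (2 * card D + 2) - Polynomial.monom (2 * (\<Sum>r\<in>D. e r)) (2 * card D + 1) + g"
  using assms
proof (induction D rule: finite_induct)
  case empty
  show ?case by (intro exI[of _ 0]) (simp add: monom_altdef numeral_2_eq_2)
next
  case (insert a D)
  define m where "m = card D"
  define s where "s = (\<Sum>r\<in>D. e r)"
  let ?b = "e a"
  obtain g where g: "degree g \<le> 2 * m" "[:0, 0, 1:] * (\<Prod>r\<in>D. [:- e r, 1:]\<^sup>2) =
    Polynomial.monom 1 (2 * m + 2) - Polynomial.monom (2 * s) (2 * m + 1) + g"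
    using insert.IH unfolding m_def s_def by auto
  have sq: "[:- ?b, 1:]\<^sup>2 = Polynomial.monom 1 2 - Polynomial.monom (2 * ?b) 1 + Polynomial.monom (?b\<^sup>2) 0"
    by (simp add: monom_altdef power2_eq_square numeral_2_eq_2)
  have "[:0, 0, 1:] * (\<Prod>r\<in>insert a D. [:- e r, 1:]\<^sup>2) =
      (Polynomial.monom 1 (2 * m + 2) - Polynomial.monom (2 * s) (2 * m + 1) + g) * [:- ?b, 1:]\<^sup>2"
    unfolding g(2)[symmetric] prod.insert[OF insert.hyps] by (simp only: mult_ac)
  also have "\<dots> = Polynomial.monom 1 (2 * m + 4) - Polynomial.monom (2 * (s + ?b)) (2 * m + 3) +
      (Polynomial.monom (?b\<^sup>2 + 4 * ?b * s) (2 * m + 2) - Polynomial.monom (2 * s * ?b\<^sup>2) (2 * m + 1) + g * [:- ?b, 1:]\<^sup>2)"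
    unfolding distrib_right[of _ g] unfolding sq
    by (simp add: mult_monom ring_distribs left_diff_distrib right_diff_distrib add_monom[symmetric]
      numeral_eq_Suc)
  finally have "[:0, 0, 1:] * (\<Prod>r\<in>insert a D. [:- e r, 1:]\<^sup>2) = \<dots>" .
  moreover have "degree (Polynomial.monom (?b\<^sup>2 + 4 * ?b * s) (2 * m + 2) - Polynomial.monom (2 * s * ?b\<^sup>2) (2 * m + 1) +
      g * [:- ?b, 1:]\<^sup>2) \<le> 2 * m + 2"
  proof (intro degree_add_le degree_diff_le)
    have "degree (g * [:- ?b, 1:]\<^sup>2) \<le> degree g + degree ([:- ?b, 1:]\<^sup>2)"
      by (rule degree_mult_le)
    also have "degree ([:- ?b, 1:]\<^sup>2) = 2"
      by (subst degree_power_eq) auto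
    finally show "degree (g * [:- ?b, 1:]\<^sup>2) \<le> 2 * m + 2" using g(1) by simp
  qed (auto intro: order_trans[OF degree_monom_le])
  ultimately show ?case
    using insert.hyps by (intro exI conjI)
      (auto simp: m_def s_def numeral_eq_Suc add.commute[of "e a"])
qed

text \<open>For each \<open>A\<close> the bracket is a cubic with leading part 3s x^3 + 6s^2 x^2,
  where s is \<open>signed_sum 1\<close>. The product of squares starts with x^(2m) - 2s x^(2m-1),
  with the same s, so the coefficient at 2m + 2 is 6s^2 - 3s * 2s = 0. The odd coefficients at 2m +
  3 and 2m + 1 survive in single summands and disappear only from the total, by evenness.\<close>

lemma degree_hirota_poly:
  assumes "finite D"
  shows "degree (hirota_poly D) \<le> 2 * card D"
proof -
  define m where "m = card D"
  have low: "Polynomial.coeff (([:s, 1:] ^ 4 - [:s, 1:] * [:k, 0, 0, 1:]) *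
      (\<Prod>r\<in>D. [:if r \<in> A then - r else r, 1:]\<^sup>2)) j = 0"
    if "s = signed_sum 1 A (D - A)" "A \<subseteq> D" "j = 2 * m + 2 \<or> j > 2 * m + 3" for A s k j
  proof -
    define N where "N = (\<Prod>r\<in>D. [:if r \<in> A then - r else r, 1:]\<^sup>2)"
    have N: "N = (\<Prod>r\<in>D. [:- (if r \<in> A then r else - r), 1:]\<^sup>2)"
      unfolding N_def by (intro prod.cong) auto
    have s: "s = (\<Sum>r\<in>D. if r \<in> A then r else - r)"
      using assms that(2) by (simp add: that(1) signed_sum_def sum.If_cases sum_negf
        Int_absorb1 Diff_eq)
    obtain g where g: "degree g \<le> 2 * m" "[:0, 0, 1:] * N =
        Polynomial.monom 1 (2 * m + 2) - Polynomial.monom (2 * s) (2 * m + 1) + g"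
      using prod_linear_squared_expansion[OF assms, of "\<lambda>r. if r \<in> A then r else - r"]
      unfolding N s m_def by blast
    have degN: "degree N \<le> 2 * m"
    proof -
      have "degree N \<le> (\<Sum>r\<in>D. degree ([:if r \<in> A then - r else r, 1:]\<^sup>2))"
        unfolding N_def by (rule degree_prod_sum_le[OF assms, unfolded o_def])
      also have "\<dots> = (\<Sum>r\<in>D. 2)" by (intro sum.cong) (auto simp: degree_power_eq)
      finally show ?thesis by (simp add: m_def mult.commute)
    qed
    \<comment> \<open>The fourth powers of x cancel. The remaining cubic is written as x^2 times a
      linear factor plus a linear remainder, whose product with \<open>N\<close> has degree at most
      2m + 1.\<close>
    have "[:s, 1:] ^ 4 - [:s, 1:] * [:k, 0, 0, 1:] =
        [:0, 0, 1:] * [:6 * s\<^sup>2, 3 * s:] + [:s ^ 4 - s * k, 4 * s ^ 3 - k:]"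
      by (simp add: numeral_eq_Suc algebra_simps)
    then have "([:s, 1:] ^ 4 - [:s, 1:] * [:k, 0, 0, 1:]) * N =
        ([:0, 0, 1:] * N) * [:6 * s\<^sup>2, 3 * s:] + [:s ^ 4 - s * k, 4 * s ^ 3 - k:] * N"
      by (simp only: ring_distribs mult_ac)
    \<comment> \<open>No monomial of exponent 2m + 2 is left: this is the cancellation 6s^2 - 2s *
      3s.\<close>
    also have "\<dots> = Polynomial.monom (3 * s) (2 * m + 3) +
        (g * [:6 * s\<^sup>2, 3 * s:] + [:s ^ 4 - s * k, 4 * s ^ 3 - k:] * N - Polynomial.monom (12 * s ^ 3) (2 * m + 1))"
    proof -
      have "[:6 * s\<^sup>2, 3 * s:] = Polynomial.monom (6 * s\<^sup>2) 0 + Polynomial.monom (3 * s) 1"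
        by (simp add: monom_altdef)
      then show ?thesis
        unfolding g(2) by (simp add: ring_distribs left_diff_distrib mult_monom numeral_eq_Suc
          algebra_simps diff_monom[symmetric] add_monom[symmetric])
    qed
    also have "Polynomial.coeff \<dots> j = 0"
    proof -
      have "degree (g * [:6 * s\<^sup>2, 3 * s:]) \<le> 2 * m + 1"
        by (rule order_trans[OF degree_mult_le]) (use g(1) in auto)
      then have 1: "Polynomial.coeff (g * [:6 * s\<^sup>2, 3 * s:]) j = 0"
        by (intro coeff_eq_0) (use that(3) in auto)
      have "degree ([:s ^ 4 - s * k, 4 * s ^ 3 - k:] * N) \<le> 2 * m + 1"
        by (rule order_trans[OF degree_mult_le]) (use degN in auto)
      then have 2: "Polynomial.coeff ([:s ^ 4 - s * k, 4 * s ^ 3 - k:] * N) j = 0"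
        by (intro coeff_eq_0) (use that(3) in auto)
      show ?thesis
        unfolding Polynomial.coeff_add Polynomial.coeff_diff 1 2 Polynomial.coeff_monom using that(3) by auto
    qed
    finally show ?thesis by (simp add: N_def)
  qed
  have high: "Polynomial.coeff (hirota_poly D) j = 0" if "j = 2 * m + 2 \<or> j > 2 * m + 3" for j
    unfolding hirota_poly_def coeff_sum Polynomial.coeff_smult
    by (intro sum.neutral ballI) (use low that in auto)
  have "poly (pcompose (hirota_poly D) [:0, -1:]) = poly (hirota_poly D)"
    by (simp add: fun_eq_iff poly_pcompose poly_hirota_poly_minus)
  then have "pcompose (hirota_poly D) [:0, -1:] = hirota_poly D"
    by (simp only: poly_eq_poly_eq_iff)
  then have odd: "Polynomial.coeff (hirota_poly D) j = (-1) ^ j * Polynomial.coeff (hirota_poly D) j" for j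
    by (metis coeff_pcompose_linear)
  show ?thesis
  proof (intro degree_le allI impI)
    fix j assume j: "2 * card D < j"
    show "Polynomial.coeff (hirota_poly D) j = 0"
    proof (cases "odd j")
      case True
      then show ?thesis using odd[of j] by simp
    next
      case False
      then have "j = 2 * m + 2 \<or> j > 2 * m + 3" using j unfolding m_def by presburger
      then show ?thesis by (rule high)
    qed
  qed
qed

text \<open>One point \<open>a\<close> becomes the variable and \<open>E\<close> is the rest. The
  root at 0 comes from the sum for \<open>E\<close>, the root at r in \<open>E\<close> from the sum
  for \<open>E - {r}\<close>, two points fewer than \<open>D\<close>. This is why the induction is a
  strong one on cardinality.\<close>

theorem hirota_sum_eq_0:
  assumes "finite D" "\<And>q r. q \<in> D \<Longrightarrow> r \<in> D \<Longrightarrow> q + r \<noteq> 0"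
  shows "hirota_sum D = 0"
  using assms
proof (induction "card D" arbitrary: D rule: less_induct)
  case less
  show ?case
  proof (cases "D = {}")
    case True
    then show ?thesis by (simp add: hirota_sum_def signed_sum_def)
  next
    case False
    then obtain a where "a \<in> D" by blast
    define E where "E = D - {a}"
    have D: "D = insert a E" "a \<notin> E" "finite E" using \<open>a \<in> D\<close> less.prems by (auto simp: E_def)
    have nz: "q + r \<noteq> 0" if "q \<in> D" "r \<in> D" for q r using less.prems(2) that by blast
    have IH: "hirota_sum F = 0" if "F \<subseteq> E" for F
    proof (rule less.hyps)
      show "card F < card D"
        using that D by (metis card_insert_disjoint card_mono less_Suc_eq_le)
      show "finite F" using that D(3) finite_subset by blast
    qed (use that D nz in auto)
    have "hirota_poly E = 0"
    proof (rule ccontr)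
      assume nonzero: "hirota_poly E \<noteq> 0"
      \<comment> \<open>These are \<open>2 * card E + 1\<close> distinct points because no two
        points of \<open>D\<close>, equal or not, add up to 0. That exceeds the degree by one, so
        simple roots suffice.\<close>
      define Z where "Z = insert 0 (E \<union> uminus ` E)"
      have roots: "poly (hirota_poly E) x = 0" if "x \<in> Z" for x
      proof -
        have "poly (hirota_poly E) x = 0" if "x \<in> E" for x
          using that D nz by (subst poly_hirota_poly_root) (auto simp: IH)
        then show ?thesis
          using that by (auto simp: Z_def poly_hirota_poly_0 poly_hirota_poly_minus IH)
      qed
      have "0 \<notin> E" using nz[of 0 0] D by auto
      moreover have "E \<inter> uminus ` E = {}" using nz D by (auto simp: add_eq_0_iff2)
      ultimately have "card Z = 2 * card E + 1"
      proof -
        have "card (E \<union> uminus ` E) = card E + card (uminus ` E)"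
          using D(3) \<open>E \<inter> uminus ` E = {}\<close> by (intro card_Un_disjoint) auto
        moreover have "0 \<notin> E \<union> uminus ` E" using \<open>0 \<notin> E\<close> by auto
        ultimately show ?thesis
          unfolding Z_def using D(3) by (subst card_insert_disjoint) (auto simp: card_image)
      qed
      moreover have "card Z \<le> card {x. poly (hirota_poly E) x = 0}"
        by (rule card_mono) (use roots nonzero poly_roots_finite in auto)
      moreover have "card {x. poly (hirota_poly E) x = 0} \<le> degree (hirota_poly E)"
        by (rule card_poly_roots_bound[OF nonzero])
      ultimately show False using degree_hirota_poly[OF D(3)] by simp
    qed
    moreover have "(\<Prod>r\<in>E. (a + r)\<^sup>2) \<noteq> 0" using D nz by auto
    moreover have "hirota_sum D * (\<Prod>r\<in>E. (a + r)\<^sup>2) = 2 * poly (hirota_poly E) a"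
      unfolding D(1) using D nz by (intro hirota_sum_insert) auto
    ultimately show ?thesis by simp
  qed
qed

section \<open>The bilinear identity for sums over finite subsets\<close>

lemma has_sum_diff:
  fixes f g :: "'a \<Rightarrow> 'b :: topological_ab_group_add"
  assumes "(f has_sum a) A" "(g has_sum b) A"
  shows "((\<lambda>x. f x - g x) has_sum (a - b)) A"
proof -
  have "((\<lambda>x. - g x) has_sum - b) A" using assms(2) by (simp only: has_sum_uminus minus_minus)
  from has_sum_add[OF assms(1) this] show ?thesis by (simp only: diff_conv_add_uminus)
qed

lemma has_sum_times:
  fixes f :: "'a \<Rightarrow> 'c :: {real_normed_field, banach}" and g :: "'b \<Rightarrow> 'c"
  assumes "(\<lambda>x. norm (f x)) summable_on A" "(\<lambda>y. norm (g y)) summable_on B"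
  shows "((\<lambda>(x, y). f x * g y) has_sum (infsum f A * infsum g B)) (A \<times> B)"
proof (rule has_sum_SigmaI)
  show "((\<lambda>y. case (x, y) of (x, y) \<Rightarrow> f x * g y) has_sum f x * infsum g B) B" for x
    unfolding prod.case by (rule has_sum_cmult_right[OF has_sum_infsum[OF abs_summable_summable[OF assms(2)]]])
  show "((\<lambda>x. f x * infsum g B) has_sum infsum f A * infsum g B) A"
    by (rule has_sum_cmult_left[OF has_sum_infsum[OF abs_summable_summable[OF assms(1)]]])
  have "(\<lambda>p. norm (case p of (x, y) \<Rightarrow> f x * g y)) summable_on A \<times> B"
  proof (rule summable_on_SigmaI)
    show "((\<lambda>y. norm (case (x, y) of (x, y) \<Rightarrow> f x * g y)) has_sum
        norm (f x) * (\<Sum>\<^sub>\<infinity>y\<in>B. norm (g y))) B" for x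
      unfolding prod.case norm_mult by (rule has_sum_cmult_right[OF has_sum_infsum[OF assms(2)]])
    show "(\<lambda>x. norm (f x) * (\<Sum>\<^sub>\<infinity>y\<in>B. norm (g y))) summable_on A"
      by (rule summable_on_cmult_left[OF assms(1)])
  qed simp
  then show "(\<lambda>(x, y). f x * g y) summable_on A \<times> B"
    by (rule abs_summable_summable)
qed

definition finite_subsets :: "'a set \<Rightarrow> 'a set set" where
  "finite_subsets S = {A. finite A \<and> A \<subseteq> S}"

lemma signed_sum_Un:
  assumes "finite A" "finite B" "finite C" "A \<inter> C = {}" "B \<inter> C = {}"
  shows "signed_sum n (C \<union> A) (C \<union> B) = signed_sum n A B"
proof -
  have "(\<Sum>q\<in>C \<union> A. q ^ n) = (\<Sum>q\<in>C. q ^ n) + (\<Sum>q\<in>A. q ^ n)"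
    by (rule sum.union_disjoint) (use assms in auto)
  moreover have "(\<Sum>q\<in>C \<union> B. q ^ n) = (\<Sum>q\<in>C. q ^ n) + (\<Sum>q\<in>B. q ^ n)"
    by (rule sum.union_disjoint) (use assms in auto)
  ultimately show ?thesis by (simp add: signed_sum_def)
qed

text \<open>Grouping the pairs \<open>(A, B)\<close> by \<open>C = A \<inter> B\<close> and by the symmetric difference \<open>D\<close> factors each
  partial sum as a multiple of \<open>hirota_sum D\<close>.\<close>
lemma soliton_pair_sum_eq_0:
  fixes v :: "complex \<Rightarrow> complex"
  defines "t \<equiv> \<lambda>A. soliton_weight A * (\<Prod>q\<in>A. v q)"
  assumes nz: "\<And>q r. q \<in> S \<Longrightarrow> r \<in> S \<Longrightarrow> q + r \<noteq> 0"
  assumes hs: "((\<lambda>(A, B). t A * t B * (signed_sum 1 A B ^ 4 - signed_sum 1 A B * signed_sum 3 A B))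
    has_sum s) (finite_subsets S \<times> finite_subsets S)"
  shows "s = 0"
proof -
  define X where "X = {(C, D). C \<in> finite_subsets S \<and> D \<in> finite_subsets S \<and> C \<inter> D = {}}"
  define Y where "Y = Sigma X (\<lambda>(C, D). Pow D)"
  define f where "f = (\<lambda>(A, B). t A * t B *
    (signed_sum 1 A B ^ 4 - signed_sum 1 A B * signed_sum 3 A B))"
  define g :: "(complex set \<times> complex set) \<times> complex set \<Rightarrow> complex set \<times> complex set"
    where "g = (\<lambda>((C, D), A). (C \<union> A, C \<union> (D - A)))"
  \<comment> \<open>The part common to all pairs with intersection \<open>C\<close> and symmetric
    difference \<open>D\<close>: the interactions of \<open>C\<close> with \<open>A\<close> and with
    \<open>D - A\<close> combine into interactions with all of \<open>D\<close>, whatever the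
    splitting.\<close>
  define K where "K = (\<lambda>C D. soliton_weight C * (\<Prod>q\<in>C. v q) * (soliton_weight C * (\<Prod>q\<in>C. v q)) *
    (\<Prod>c\<in>C. \<Prod>d\<in>D. ((c - d) / (c + d))\<^sup>2) * (\<Prod>q\<in>D. v q))"
  have bij: "bij_betw g Y (finite_subsets S \<times> finite_subsets S)"
  proof (rule bij_betw_byWitness[where f' = "\<lambda>(A, B). ((A \<inter> B, (A - B) \<union> (B - A)), A - B)"])
    show "g ` Y \<subseteq> finite_subsets S \<times> finite_subsets S"
    proof (rule image_subsetI)
      fix y assume "y \<in> Y"
      then obtain C D A where y: "y = ((C, D), A)" "(C, D) \<in> X" "A \<subseteq> D"
        by (auto simp: Y_def)
      then have "finite A" by (auto simp: X_def finite_subsets_def dest: finite_subset)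
      then show "g y \<in> finite_subsets S \<times> finite_subsets S"
        using y by (auto simp: g_def X_def finite_subsets_def)
    qed
    show "\<forall>y\<in>Y. (\<lambda>(A, B). ((A \<inter> B, (A - B) \<union> (B - A)), A - B)) (g y) = y"
      by (auto simp: g_def Y_def X_def)
    show "(\<lambda>(A, B). ((A \<inter> B, (A - B) \<union> (B - A)), A - B)) ` (finite_subsets S \<times> finite_subsets S) \<subseteq> Y"
      by (auto simp: Y_def X_def finite_subsets_def)
  qed (auto simp: g_def)
  have fg: "f (g ((C, D), A)) = K C D * (soliton_weight A * soliton_weight (D - A) *
     (signed_sum 1 A (D - A) ^ 4 - signed_sum 1 A (D - A) * signed_sum 3 A (D - A)))"
    if "(C, D) \<in> X" "A \<subseteq> D" for C D A
  proof -
    have "finite A" using that by (auto simp: X_def finite_subsets_def dest: finite_subset)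
    then have fin: "finite C" "finite D" "finite A" "finite (D - A)" "C \<inter> D = {}"
      using that by (auto simp: X_def finite_subsets_def)
    have dis: "C \<inter> A = {}" "C \<inter> (D - A) = {}" using fin(5) that(2) by auto
    have D: "A \<union> (D - A) = D" using that(2) by auto
    have "(\<Prod>c\<in>C. \<Prod>d\<in>D. ((c - d) / (c + d))\<^sup>2) =
        (\<Prod>c\<in>C. \<Prod>d\<in>A. ((c - d) / (c + d))\<^sup>2) * (\<Prod>c\<in>C. \<Prod>d\<in>D - A. ((c - d) / (c + d))\<^sup>2)"
      unfolding prod.distrib[symmetric]
      by (intro prod.cong refl) (subst prod.subset_diff[OF that(2) fin(2)], rule mult.commute)
    moreover have "(\<Prod>q\<in>D. v q) = (\<Prod>q\<in>A. v q) * (\<Prod>q\<in>D - A. v q)"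
      by (subst prod.subset_diff[OF that(2) fin(2)], rule mult.commute)
    ultimately have "t (C \<union> A) * t (C \<union> (D - A)) = K C D * (soliton_weight A * soliton_weight (D - A))"
      using fin dis unfolding t_def K_def
      by (simp only: soliton_weight_Un prod.union_disjoint mult_ac)
    then show ?thesis
      using fin dis by (simp add: f_def g_def signed_sum_Un Int_commute mult.assoc)
  qed
  have "((\<lambda>y. f (g y)) has_sum s) Y"
    using hs unfolding f_def[symmetric] has_sum_reindex_bij_betw[OF bij] .
  then have "((\<lambda>x. 0) has_sum s) X"
    unfolding Y_def
  proof (rule has_sum_SigmaD)
    fix x assume "x \<in> X"
    then obtain C D where x: "x = (C, D)" "(C, D) \<in> X" by (cases x) auto
    have D: "finite D" "D \<subseteq> S" using x by (auto simp: X_def finite_subsets_def)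
    have "(\<Sum>A\<in>Pow D. f (g (x, A))) = K C D * hirota_sum D"
      unfolding x hirota_sum_def sum_distrib_left by (rule sum.cong) (use fg x in auto)
    also have "hirota_sum D = 0"
      using D nz by (intro hirota_sum_eq_0) auto
    finally have "(\<Sum>A\<in>Pow D. f (g (x, A))) = 0" by simp
    then show "((\<lambda>A. f (g (x, A))) has_sum 0) (case x of (C, D) \<Rightarrow> Pow D)"
      using has_sum_finite[of "Pow D" "\<lambda>A. f (g (x, A))"] D by (simp add: x)
  qed
  then show "s = 0"
    using has_sum_0_simp has_sum_unique by blast
qed

text \<open>Expanding (s-s')^4 - (s-s')(k-k') binomially turns the vanishing double sum over pairs
  into products of single sums. Exchanging the two subsets doubles every term, so the expansion is
  twice the stated identity.\<close>

lemma soliton_moments_bilinear: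
  fixes v :: "complex \<Rightarrow> complex" and S :: "complex set"
  defines "M \<equiv> \<lambda>k l A. soliton_weight A * (\<Prod>q\<in>A. v q) * (\<Sum>q\<in>A. q) ^ k * (\<Sum>q\<in>A. q ^ 3) ^ l"
  defines "G \<equiv> \<lambda>k l. \<Sum>\<^sub>\<infinity>A\<in>finite_subsets S. M k l A"
  assumes nz: "\<And>q r. q \<in> S \<Longrightarrow> r \<in> S \<Longrightarrow> q + r \<noteq> 0"
  assumes summ: "\<And>k l. (\<lambda>A. norm (M k l A)) summable_on finite_subsets S"
  shows "G 4 0 * G 0 0 - 4 * G 3 0 * G 1 0 + 3 * (G 2 0)\<^sup>2 = G 1 1 * G 0 0 - G 1 0 * G 0 1"
proof -
  define H where "H k l k' l' = (\<lambda>(A, B). M k l A * M k' l' B)" for k l k' l'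
  have H: "(H k l k' l' has_sum (G k l * G k' l')) (finite_subsets S \<times> finite_subsets S)" for k l k' l'
    unfolding H_def G_def by (rule has_sum_times[OF summ summ])
  have sum: "((\<lambda>p. (H 4 0 0 0 p - 4 * H 3 0 1 0 p + 6 * H 2 0 2 0 p - 4 * H 1 0 3 0 p + H 0 0 4 0 p)
      - (H 1 1 0 0 p - H 1 0 0 1 p - H 0 1 1 0 p + H 0 0 1 1 p)) has_sum
    ((G 4 0 * G 0 0 - 4 * (G 3 0 * G 1 0) + 6 * (G 2 0 * G 2 0) - 4 * (G 1 0 * G 3 0) + G 0 0 * G 4 0)
      - (G 1 1 * G 0 0 - G 1 0 * G 0 1 - G 0 1 * G 1 0 + G 0 0 * G 1 1)))
    (finite_subsets S \<times> finite_subsets S)"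
    by (intro has_sum_add has_sum_diff has_sum_cmult_right H)
  have "(\<lambda>p. (H 4 0 0 0 p - 4 * H 3 0 1 0 p + 6 * H 2 0 2 0 p - 4 * H 1 0 3 0 p + H 0 0 4 0 p)
      - (H 1 1 0 0 p - H 1 0 0 1 p - H 0 1 1 0 p + H 0 0 1 1 p)) =
    (\<lambda>(A, B). (soliton_weight A * (\<Prod>q\<in>A. v q)) * (soliton_weight B * (\<Prod>q\<in>B. v q)) *
      (signed_sum 1 A B ^ 4 - signed_sum 1 A B * signed_sum 3 A B))"
  proof (rule ext, clarify, goal_cases)
    case (1 A B)
    have "(a * s ^ 4 * k ^ 0 * (b * s' ^ 0 * k' ^ 0) - 4 * (a * s ^ 3 * k ^ 0 * (b * s' ^ 1 * k' ^ 0))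
        + 6 * (a * s ^ 2 * k ^ 0 * (b * s' ^ 2 * k' ^ 0)) - 4 * (a * s ^ 1 * k ^ 0 * (b * s' ^ 3 * k' ^ 0))
        + a * s ^ 0 * k ^ 0 * (b * s' ^ 4 * k' ^ 0))
        - (a * s ^ 1 * k ^ 1 * (b * s' ^ 0 * k' ^ 0) - a * s ^ 1 * k ^ 0 * (b * s' ^ 0 * k' ^ 1)
          - a * s ^ 0 * k ^ 1 * (b * s' ^ 1 * k' ^ 0) + a * s ^ 0 * k ^ 0 * (b * s' ^ 1 * k' ^ 1))
      = a * b * ((s - s') ^ 4 - (s - s') * (k - k'))" for a b s s' k k' :: complex
      by (simp add: power4_eq_xxxx power3_eq_cube power2_eq_square algebra_simps)
    then show ?case unfolding H_def M_def signed_sum_def power_one_right prod.case .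
  qed
  note zero = soliton_pair_sum_eq_0[OF nz sum[unfolded this]]
  have "2 * ((G 4 0 * G 0 0 - 4 * G 3 0 * G 1 0 + 3 * (G 2 0)\<^sup>2) - (G 1 1 * G 0 0 - G 1 0 * G 0 1)) =
    (G 4 0 * G 0 0 - 4 * (G 3 0 * G 1 0) + 6 * (G 2 0 * G 2 0) - 4 * (G 1 0 * G 3 0) + G 0 0 * G 4 0)
      - (G 1 1 * G 0 0 - G 1 0 * G 0 1 - G 0 1 * G 1 0 + G 0 0 * G 1 1)"
    by (simp add: power2_eq_square algebra_simps)
  also have "\<dots> = 0" by (rule zero)
  finally show ?thesis unfolding mult_eq_0_iff by simp
qed

section \<open>Series of exponentials\<close>

text \<open>Trades a linear factor for an exponential of arbitrarily small rate; this is how margins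
  absorb the factors that differentiation produces.\<close>

lemma le_exp_mult_divide:
  fixes x e :: real
  assumes "0 \<le> x" "0 < e"
  shows "x \<le> exp (e * x) / e"
  using exp_ge_add_one_self[of "e * x"] assms by (simp add: pos_le_divide_eq mult.commute del: exp_ge_add_one_self)

text \<open>The margin \<open>\<delta>\<close> serves two purposes: it dominates the terms at all
  parameters near \<open>p\<close>, and it makes the condition stable under multiplying the
  coefficients by \<open>a\<close> or \<open>b\<close>, hence under differentiation.\<close>

definition exp_summable_at ::
  "'i set \<Rightarrow> ('i \<Rightarrow> complex) \<Rightarrow> ('i \<Rightarrow> complex) \<Rightarrow> ('i \<Rightarrow> complex) \<Rightarrow> real \<times> real \<Rightarrow> bool" where
  "exp_summable_at I a b c p \<longleftrightarrow> (\<exists>\<delta>>0. (\<lambda>i.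
     norm (c i * exp (of_real (fst p) * a i + of_real (snd p) * b i)) * exp (\<delta> * (norm (a i) + norm (b i))))
     summable_on I)"

definition exp_series ::
  "'i set \<Rightarrow> ('i \<Rightarrow> complex) \<Rightarrow> ('i \<Rightarrow> complex) \<Rightarrow> ('i \<Rightarrow> complex) \<Rightarrow> real \<times> real \<Rightarrow> complex" where
  "exp_series I a b c p = (\<Sum>\<^sub>\<infinity>i\<in>I. c i * exp (of_real (fst p) * a i + of_real (snd p) * b i))"

lemma exp_summable_at_mult:
  assumes "exp_summable_at I a b c p" "\<And>i. i \<in> I \<Longrightarrow> norm (d i) \<le> norm (a i) + norm (b i)"
  shows "exp_summable_at I a b (\<lambda>i. d i * c i) p"
proof -
  obtain \<delta> where \<delta>: "\<delta> > 0" and s: "(\<lambda>i. norm (c i * exp (of_real (fst p) * a i + of_real (snd p) * b i)) *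
      exp (\<delta> * (norm (a i) + norm (b i)))) summable_on I"
    using assms(1) unfolding exp_summable_at_def by blast
  have "(\<lambda>i. norm (norm (d i * c i * exp (of_real (fst p) * a i + of_real (snd p) * b i)) *
      exp (\<delta> / 2 * (norm (a i) + norm (b i))))) summable_on I"
  proof (rule Infinite_Sum.abs_summable_on_comparison_test'[OF summable_on_cmult_right[OF s, of "2 / \<delta>"]])
    fix i assume i: "i \<in> I"
    let ?m = "norm (a i) + norm (b i)"
    let ?c = "norm (c i * exp (of_real (fst p) * a i + of_real (snd p) * b i))"
    have "norm (d i) \<le> 2 / \<delta> * exp (\<delta> / 2 * ?m)"
      using assms(2)[OF i] le_exp_mult_divide[of ?m "\<delta> / 2"] \<delta> by (simp add: mult.commute)
    then have "norm (d i) * ?c * exp (\<delta> / 2 * ?m) \<le> 2 / \<delta> * exp (\<delta> / 2 * ?m) * ?c * exp (\<delta> / 2 * ?m)"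
      by (intro mult_right_mono) auto
    also have "\<dots> = 2 / \<delta> * (?c * exp (\<delta> * ?m))"
      by (simp add: exp_add[symmetric] field_simps)
    finally show "norm (norm (d i * c i * exp (of_real (fst p) * a i + of_real (snd p) * b i)) *
      exp (\<delta> / 2 * ?m)) \<le> 2 / \<delta> * (?c * exp (\<delta> * ?m))"
      by (simp add: norm_mult mult.assoc)
  qed
  then show ?thesis
    unfolding exp_summable_at_def using \<delta> by (intro exI[of _ "\<delta> / 2"]) simp
qed

lemma exp_summable_at_abs_summable:
  assumes "exp_summable_at I a b c p"
  shows "(\<lambda>i. norm (c i * exp (of_real (fst p) * a i + of_real (snd p) * b i))) summable_on I"
proof -
  obtain \<delta> where \<delta>: "\<delta> > 0" and s: "(\<lambda>i. norm (c i * exp (of_real (fst p) * a i + of_real (snd p) * b i)) *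
      exp (\<delta> * (norm (a i) + norm (b i)))) summable_on I"
    using assms(1) unfolding exp_summable_at_def by blast
  show ?thesis
  proof (rule Infinite_Sum.abs_summable_on_comparison_test'[OF s])
    fix i
    show "norm (c i * exp (of_real (fst p) * a i + of_real (snd p) * b i)) \<le>
      norm (c i * exp (of_real (fst p) * a i + of_real (snd p) * b i)) * exp (\<delta> * (norm (a i) + norm (b i)))"
      using \<delta> by (intro mult_left_mono[where a = 1 and b = "exp _", simplified mult_1_right] norm_ge_zero)
        (simp add: mult_nonneg_nonneg)
  qed
qed

text \<open>The first-order Taylor remainder of each exponential is quadratic in \<open>h\<close>,
  with a summable constant. Having the total derivative rather than two partial ones also yields the
  joint continuity behind the openness of the domain.\<close>

lemma has_derivative_exp_series:
  assumes "exp_summable_at I a b c p"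
  shows "(exp_series I a b c has_derivative (\<lambda>h.
    of_real (fst h) * exp_series I a b (\<lambda>i. a i * c i) p +
    of_real (snd h) * exp_series I a b (\<lambda>i. b i * c i) p)) (at p)"
proof -
  define E where "E q i = exp (of_real (fst q) * a i + of_real (snd q) * b i)" for q :: "real \<times> real" and i
  define m where "m i = norm (a i) + norm (b i)" for i
  define lin where "lin h i = of_real (fst h) * a i + of_real (snd h) * b i" for h :: "real \<times> real" and i
  have m0: "0 \<le> m i" for i by (simp add: m_def)
  obtain \<delta> where \<delta>: "\<delta> > 0" and s: "(\<lambda>i. norm (c i * E p i) * exp (\<delta> * m i)) summable_on I"
    using assms unfolding exp_summable_at_def E_def m_def by blast
  define C where "C = (\<Sum>\<^sub>\<infinity>i\<in>I. norm (c i * E p i) * exp (\<delta> * m i))"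
  have lin_le: "norm (lin h i) \<le> norm h * m i" for h i
  proof -
    have "norm (lin h i) \<le> \<bar>fst h\<bar> * norm (a i) + \<bar>snd h\<bar> * norm (b i)"
      unfolding lin_def by (rule order_trans[OF norm_triangle_ineq]) (simp add: norm_mult)
    also have "\<dots> \<le> norm h * norm (a i) + norm h * norm (b i)"
      using norm_fst_le[of "fst h" "snd h"] norm_snd_le[of "snd h" "fst h"]
      by (intro add_mono mult_right_mono) auto
    finally show ?thesis by (simp add: m_def algebra_simps)
  qed
  have E_add: "E (p + h) i = E p i * exp (lin h i)" for h i
    by (simp add: E_def lin_def exp_add[symmetric] algebra_simps)
  have sE: "(\<lambda>i. c i * E (p + h) i) summable_on I" if "norm h \<le> \<delta> / 2" for h
  proof (rule abs_summable_summable, rule Infinite_Sum.abs_summable_on_comparison_test'[OF s])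
    fix i
    have "norm (exp (lin h i)) \<le> exp (\<delta> * m i)"
    proof -
      have "norm (lin h i) \<le> \<delta> * m i"
        by (rule order_trans[OF lin_le]) (use that \<delta> m0 in \<open>auto intro!: mult_right_mono\<close>)
      then show ?thesis using norm_exp[of "lin h i"] by (meson exp_le_cancel_iff order_trans)
    qed
    then show "norm (c i * E (p + h) i) \<le> norm (c i * E p i) * exp (\<delta> * m i)"
      unfolding E_add norm_mult mult.assoc by (intro mult_left_mono) auto
  qed
  have sa: "(\<lambda>i. a i * c i * E p i) summable_on I" and sb: "(\<lambda>i. b i * c i * E p i) summable_on I"
    unfolding E_def using exp_summable_at_mult[OF assms, of a] exp_summable_at_mult[OF assms, of b]
    by (auto intro!: abs_summable_summable exp_summable_at_abs_summable)
  let ?L = "\<lambda>h. of_real (fst h) * exp_series I a b (\<lambda>i. a i * c i) p +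
    of_real (snd h) * exp_series I a b (\<lambda>i. b i * c i) p"
  have bound: "norm (exp_series I a b c (p + h) - exp_series I a b c p - ?L h) \<le> (norm h)\<^sup>2 * (16 / \<delta>\<^sup>2 * C)"
    if h: "norm h \<le> \<delta> / 2" for h
  proof -
    have "((\<lambda>i. c i * E (p + h) i - c i * E p i -
        (of_real (fst h) * (a i * c i * E p i) + of_real (snd h) * (b i * c i * E p i))) has_sum
        (exp_series I a b c (p + h) - exp_series I a b c p - ?L h)) I"
      unfolding exp_series_def E_def[symmetric] using sE[OF h] sE[of 0] \<delta>
      by (intro has_sum_diff has_sum_add has_sum_cmult_right has_sum_infsum sa sb) auto
    moreover have "norm (c i * E (p + h) i - c i * E p i -
        (of_real (fst h) * (a i * c i * E p i) + of_real (snd h) * (b i * c i * E p i))) \<le>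
        (norm h)\<^sup>2 * (16 / \<delta>\<^sup>2 * (norm (c i * E p i) * exp (\<delta> * m i)))" for i
    proof -
      have "c i * E (p + h) i - c i * E p i -
        (of_real (fst h) * (a i * c i * E p i) + of_real (snd h) * (b i * c i * E p i)) =
        c i * E p i * (exp (lin h i) - (\<Sum>k\<le>1. lin h i ^ k / fact k))"
        unfolding E_add by (simp add: lin_def algebra_simps)
      also have "norm \<dots> \<le> norm (c i * E p i) * (exp (norm (lin h i)) * norm (lin h i) ^ Suc 1 / fact 1)"
        unfolding norm_mult by (intro mult_left_mono Taylor_exp_field) simp
      \<comment> \<open>The margin is spent as 1/2 + 1/4 + 1/4: half bounds the exponential in the
        Taylor remainder, and a quarter bounds each of the two factors
        \<open>norm (lin h i)\<close>. The latter produce (4/\<open>\<delta>\<close>)^2 =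
        16/\<open>\<delta>\<^sup>2\<close>.\<close>
      also have "\<dots> \<le> norm (c i * E p i) * (exp (\<delta> / 2 * m i) * (norm h * (exp (\<delta> / 4 * m i) / (\<delta> / 4)))\<^sup>2)"
      proof -
        have "norm (lin h i) \<le> \<delta> / 2 * m i"
          by (rule order_trans[OF lin_le mult_right_mono[OF h m0]])
        moreover have "norm (lin h i) \<le> norm h * (exp (\<delta> / 4 * m i) / (\<delta> / 4))"
          by (rule order_trans[OF lin_le]) (intro mult_left_mono le_exp_mult_divide, use m0 \<delta> in auto)
        ultimately show ?thesis
          by (intro mult_left_mono) (auto intro!: mult_mono power_mono simp flip: power2_eq_square)
      qed
      also have "\<dots> = (norm h)\<^sup>2 * (16 / \<delta>\<^sup>2 * (norm (c i * E p i) * (exp (\<delta> / 2 * m i) * exp (\<delta> / 4 * m i) * exp (\<delta> / 4 * m i))))"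
        using \<delta> by (simp add: field_simps power2_eq_square)
      also have "exp (\<delta> / 2 * m i) * exp (\<delta> / 4 * m i) * exp (\<delta> / 4 * m i) = exp (\<delta> * m i)"
        unfolding exp_add[symmetric] by (simp add: field_simps)
      finally show ?thesis .
    qed
    ultimately show ?thesis
      unfolding C_def
      by (rule norm_infsum_le[OF _ has_sum_cmult_right[OF has_sum_cmult_right[OF has_sum_infsum[OF s]]]])
  qed
  have C0: "0 \<le> C" unfolding C_def by (intro infsum_nonneg) auto
  show ?thesis
    unfolding has_derivative_at_alt
  proof (intro conjI allI impI)
    show "bounded_linear ?L"
      by (intro bounded_linear_add bounded_linear_mult_const
          bounded_linear_compose[OF bounded_linear_of_real] bounded_linear_fst bounded_linear_snd)
    fix e :: real assume e: "e > 0"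
    define d where "d = min (\<delta> / 2) (e / (16 / \<delta>\<^sup>2 * C + 1))"
    have pos: "16 / \<delta>\<^sup>2 * C + 1 > 0" using C0 by (simp add: add_nonneg_pos)
    show "\<exists>d>0. \<forall>y. norm (y - p) < d \<longrightarrow>
      norm (exp_series I a b c y - exp_series I a b c p - ?L (y - p)) \<le> e * norm (y - p)"
    proof (intro exI[of _ d] conjI allI impI)
      show "d > 0" using \<delta> e pos by (simp add: d_def)
      fix y assume y: "norm (y - p) < d"
      have "norm (exp_series I a b c (p + (y - p)) - exp_series I a b c p - ?L (y - p)) \<le>
        (norm (y - p))\<^sup>2 * (16 / \<delta>\<^sup>2 * C)"
        by (rule bound) (use y in \<open>simp add: d_def\<close>)
      also have "\<dots> \<le> (norm (y - p))\<^sup>2 * (16 / \<delta>\<^sup>2 * C + 1)"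
        by (intro mult_left_mono) auto
      also have "\<dots> = norm (y - p) * (norm (y - p) * (16 / \<delta>\<^sup>2 * C + 1))"
        by (simp add: power2_eq_square)
      also have "\<dots> \<le> norm (y - p) * e"
        using y pos by (intro mult_left_mono) (auto simp: d_def pos_less_divide_eq less_imp_le)
      finally show "norm (exp_series I a b c y - exp_series I a b c p - ?L (y - p)) \<le> e * norm (y - p)"
        by (simp add: mult.commute)
    qed
  qed
qed

text \<open>Any finite family of subsets lies in the power set of its union, over which the products
  add up to the product of 1 + \<open>b q\<close>, at most the exponential of the whole sum.\<close>

lemma summable_on_prod_finite_subsets:
  fixes b :: "'a \<Rightarrow> real"
  assumes "b summable_on S" "\<And>q. q \<in> S \<Longrightarrow> 0 \<le> b q"
  shows "(\<lambda>A. \<Prod>q\<in>A. b q) summable_on {A. finite A \<and> A \<subseteq> S}"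
proof (rule nonneg_bdd_above_summable_on)
  show "bdd_above (sum (\<lambda>A. \<Prod>q\<in>A. b q) ` {F. F \<subseteq> {A. finite A \<and> A \<subseteq> S} \<and> finite F})"
  proof (rule bdd_aboveI2)
    fix F assume "F \<in> {F. F \<subseteq> {A. finite A \<and> A \<subseteq> S} \<and> finite F}"
    then have F: "finite F" "\<And>A. A \<in> F \<Longrightarrow> finite A \<and> A \<subseteq> S" by auto
    have U: "finite (\<Union>F)" "\<Union>F \<subseteq> S" using F by auto
    have "(\<Sum>A\<in>F. \<Prod>q\<in>A. b q) \<le> (\<Sum>A\<in>Pow (\<Union>F). \<Prod>q\<in>A. b q)"
      using U assms(2) by (intro sum_mono2) (auto intro!: prod_nonneg dest!: subsetD)
    also have "\<dots> = (\<Prod>q\<in>\<Union>F. b q + 1)"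
      by (simp add: prod_add[OF U(1)])
    also have "\<dots> \<le> (\<Prod>q\<in>\<Union>F. exp (b q))"
      using U assms(2) exp_ge_add_one_self by (intro prod_mono) (auto simp: add.commute add_nonneg_nonneg)
    also have "\<dots> = exp (\<Sum>q\<in>\<Union>F. b q)"
      by (rule exp_sum[OF U(1), symmetric])
    also have "\<dots> \<le> exp (infsum b S)"
      using finite_sum_le_infsum[OF assms(1) U] assms(2) by auto
    finally show "(\<Sum>A\<in>F. \<Prod>q\<in>A. b q) \<le> exp (infsum b S)" .
  qed
qed (use assms(2) in \<open>auto intro!: prod_nonneg\<close>)

section \<open>From the bilinear equation to KdV\<close>

lemma has_vector_derivative_quotient:
  fixes f g :: "real \<Rightarrow> complex"
  assumes "(f has_vector_derivative f') (at x)" "(g has_vector_derivative g') (at x)" "g x \<noteq> 0"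
  shows "((\<lambda>y. f y / g y) has_vector_derivative (f' / g x - f x / g x * (g' / g x))) (at x)"
  unfolding has_vector_derivative_def
  by (rule has_derivative_eq_rhs[OF has_derivative_divide[OF assms(1,2)[unfolded has_vector_derivative_def] assms(3)]])
    (use assms(3) in \<open>auto simp: fun_eq_iff field_simps scaleR_conv_of_real\<close>)

text \<open>The quotient \<open>f y / f x\<close> equals 1 at \<open>y = x\<close>, so it avoids the
  cut of \<open>Ln\<close> on an open neighbourhood \<open>V\<close>. There the logarithmic
  derivative is \<open>f1 y / f y\<close>, and knowing it on all of \<open>V\<close> permits the
  second differentiation.\<close>

lemma log_near_second_derivative:
  fixes f f1 f2 :: "real \<Rightarrow> complex"
  assumes f: "\<And>y. (f has_vector_derivative f1 y) (at y)"
    and f1: "\<And>y. (f1 has_vector_derivative f2 y) (at y)"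
    and nz: "f x \<noteq> 0"
  shows "twice_differentiable_at (\<lambda>y. log_near (f x) (f y)) x"
    and "second_derivative (\<lambda>y. log_near (f x) (f y)) x = f2 x / f x - (f1 x / f x)\<^sup>2"
proof -
  define V where "V = {y. f y / f x \<notin> \<real>\<^sub>\<le>\<^sub>0}"
  have cont: "continuous_on UNIV f"
    using f by (meson continuous_on_eq_continuous_within has_vector_derivative_continuous
      has_vector_derivative_at_within)
  have "open V"
  proof -
    have "V = (\<lambda>y. f y / f x) -` (- \<real>\<^sub>\<le>\<^sub>0)" by (auto simp: V_def)
    then show ?thesis
      using nz by (auto intro!: open_vimage continuous_intros cont)
  qed
  moreover have "x \<in> V" using nz by (simp add: V_def)
  ultimately have V: "\<forall>\<^sub>F y in nhds x. y \<in> V" by (rule eventually_nhds_in_open)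
  have der: "((\<lambda>y. log_near (f x) (f y)) has_vector_derivative (f1 y / f y)) (at y)" if "y \<in> V" for y
  proof -
    have nzy: "f y \<noteq> 0" using that by (auto simp: V_def)
    have "((\<lambda>w. log_near (f x) w) has_field_derivative (1 / f y)) (at (f y))"
      unfolding log_near_def
      by (rule derivative_eq_intros refl | use that nz nzy in \<open>simp add: V_def field_simps\<close>)+
    from field_vector_diff_chain_at[OF f this] show ?thesis
      by (simp add: o_def)
  qed
  have vd: "vector_derivative (\<lambda>y. log_near (f x) (f y)) (at y) = f1 y / f y" if "y \<in> V" for y
    by (rule vector_derivative_at[OF der[OF that]])
  have second: "((\<lambda>y. vector_derivative (\<lambda>y. log_near (f x) (f y)) (at y)) has_vector_derivative
      (f2 x / f x - f1 x / f x * (f1 x / f x))) (at x)"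
    by (rule has_vector_derivative_transform_within_open
        [OF has_vector_derivative_quotient[OF f1 f nz] \<open>open V\<close> \<open>x \<in> V\<close>]) (simp add: vd)
  show "second_derivative (\<lambda>y. log_near (f x) (f y)) x = f2 x / f x - (f1 x / f x)\<^sup>2"
    unfolding second_derivative_def power2_eq_square by (rule vector_derivative_at[OF second])
  show "twice_differentiable_at (\<lambda>y. log_near (f x) (f y)) x"
    unfolding twice_differentiable_at_def
  proof
    show "\<forall>\<^sub>F y in nhds x. (\<lambda>y. log_near (f x) (f y)) differentiable at y"
      using V by eventually_elim (use der in \<open>auto intro: differentiableI_vector\<close>)
  qed (use second in \<open>auto intro: differentiableI_vector\<close>)
qed

text \<open>These ratios are closed under differentiation: the x-derivative of
  \<open>jet G k l\<close> is \<open>jet G (Suc k) l\<close> minus \<open>jet G k l\<close> times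
  \<open>jet G 1 0\<close>. Derivatives of u thus stay polynomial in them.\<close>

definition jet :: "(nat \<Rightarrow> nat \<Rightarrow> real \<Rightarrow> real \<Rightarrow> complex) \<Rightarrow> nat \<Rightarrow> nat \<Rightarrow> real \<Rightarrow> real \<Rightarrow> complex" where
  "jet G k l t x = G k l t x / G 0 0 t x"

text \<open>The following functions are \<open>2 \<partial>\<^sub>x\<^sub>x log G\<close> and its derivatives, in terms of the ratios
  \<open>(\<partial>\<^sub>x\<^sup>k \<partial>\<^sub>t\<^sup>l G) / G\<close>.\<close>

definition kdv_u :: "(nat \<Rightarrow> nat \<Rightarrow> real \<Rightarrow> real \<Rightarrow> complex) \<Rightarrow> real \<Rightarrow> real \<Rightarrow> complex" where
  "kdv_u G t x = 2 * (jet G 2 0 t x - jet G 1 0 t x * jet G 1 0 t x)"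

definition kdv_ux :: "(nat \<Rightarrow> nat \<Rightarrow> real \<Rightarrow> real \<Rightarrow> complex) \<Rightarrow> real \<Rightarrow> real \<Rightarrow> complex" where
  "kdv_ux G t x = (let r = (\<lambda>k. jet G k 0 t x) in
     2 * (r 3 - 3 * (r 1 * r 2) + 2 * (r 1 * (r 1 * r 1))))"

definition kdv_uxx :: "(nat \<Rightarrow> nat \<Rightarrow> real \<Rightarrow> real \<Rightarrow> complex) \<Rightarrow> real \<Rightarrow> real \<Rightarrow> complex" where
  "kdv_uxx G t x = (let r = (\<lambda>k. jet G k 0 t x) in
     2 * (r 4 - 4 * (r 1 * r 3) - 3 * (r 2 * r 2) + 12 * (r 1 * (r 1 * r 2)) -
       6 * (r 1 * (r 1 * (r 1 * r 1)))))"

definition kdv_uxxx :: "(nat \<Rightarrow> nat \<Rightarrow> real \<Rightarrow> real \<Rightarrow> complex) \<Rightarrow> real \<Rightarrow> real \<Rightarrow> complex" where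
  "kdv_uxxx G t x = (let r = (\<lambda>k. jet G k 0 t x) in
     2 * (r 5 - 5 * (r 1 * r 4) - 10 * (r 2 * r 3) + 20 * (r 1 * (r 1 * r 3)) +
       30 * (r 1 * (r 2 * r 2)) - 60 * (r 1 * (r 1 * (r 1 * r 2))) +
       24 * (r 1 * (r 1 * (r 1 * (r 1 * r 1))))))"

definition kdv_ut :: "(nat \<Rightarrow> nat \<Rightarrow> real \<Rightarrow> real \<Rightarrow> complex) \<Rightarrow> real \<Rightarrow> real \<Rightarrow> complex" where
  "kdv_ut G t x = (let r = (\<lambda>k l. jet G k l t x) in
     2 * (r 2 1 - r 2 0 * r 0 1 - 2 * (r 1 0 * (r 1 1 - r 1 0 * r 0 1))))"

theorem KdV_of_Hirota:
  fixes G :: "nat \<Rightarrow> nat \<Rightarrow> real \<Rightarrow> real \<Rightarrow> complex"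
  assumes dx: "\<And>k l y. (G k l t has_vector_derivative G (Suc k) l t y) (at y)"
    and dt: "\<And>k l. ((\<lambda>s. G k l s x) has_vector_derivative G k (Suc l) t x) (at t)"
    and bilinear: "\<And>y. G 4 0 t y * G 0 0 t y - 4 * G 3 0 t y * G 1 0 t y + 3 * (G 2 0 t y)\<^sup>2 +
      3 * (G 1 1 t y * G 0 0 t y - G 1 0 t y * G 0 1 t y) = 0"
    and nz: "G 0 0 t x \<noteq> 0"
  shows "((\<lambda>s. kdv_u G s x) has_vector_derivative kdv_ut G t x) (at t)"
    and "(kdv_u G t has_vector_derivative kdv_ux G t x) (at x)"
    and "(kdv_ux G t has_vector_derivative kdv_uxx G t x) (at x)"
    and "(kdv_uxx G t has_vector_derivative kdv_uxxx G t x) (at x)"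
    and "3 * kdv_ut G t x + kdv_uxxx G t x + 6 * kdv_u G t x * kdv_ux G t x = 0"
proof -
  let ?r = "jet G"
  have rx: "(?r k l t has_vector_derivative (?r (Suc k) l t x - ?r k l t x * ?r 1 0 t x)) (at x)" for k l
    unfolding jet_def using has_vector_derivative_quotient[OF dx dx nz] by simp
  have rt: "((\<lambda>s. ?r k l s x) has_vector_derivative (?r k (Suc l) t x - ?r k l t x * ?r 0 1 t x)) (at t)" for k l
    unfolding jet_def using has_vector_derivative_quotient[OF dt dt nz] by simp
  note ders = has_vector_derivative_add has_vector_derivative_diff has_vector_derivative_mult
    has_vector_derivative_const rx rt
  show "((\<lambda>s. kdv_u G s x) has_vector_derivative kdv_ut G t x) (at t)"
    unfolding kdv_u_def kdv_ut_def Let_def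
    by (rule has_vector_derivative_eq_rhs, (rule ders)+) (simp add: numeral_eq_Suc algebra_simps)
  show "(kdv_u G t has_vector_derivative kdv_ux G t x) (at x)"
    unfolding kdv_u_def kdv_ux_def Let_def
    by (rule has_vector_derivative_eq_rhs, (rule ders)+) (simp add: eval_nat_numeral algebra_simps)
  show "(kdv_ux G t has_vector_derivative kdv_uxx G t x) (at x)"
    unfolding kdv_ux_def Let_def kdv_uxx_def Let_def
    by (rule has_vector_derivative_eq_rhs, (rule ders)+) (simp add: eval_nat_numeral algebra_simps)
  show "(kdv_uxx G t has_vector_derivative kdv_uxxx G t x) (at x)"
    unfolding kdv_uxx_def Let_def kdv_uxxx_def Let_def
    by (rule has_vector_derivative_eq_rhs, (rule ders)+) (simp add: eval_nat_numeral algebra_simps)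
  have B: "?r 4 0 t x - 4 * ?r 3 0 t x * ?r 1 0 t x + 3 * (?r 2 0 t x)\<^sup>2 +
      3 * (?r 1 1 t x - ?r 1 0 t x * ?r 0 1 t x) = 0"
  proof -
    have "?r 4 0 t x - 4 * ?r 3 0 t x * ?r 1 0 t x + 3 * (?r 2 0 t x)\<^sup>2 +
        3 * (?r 1 1 t x - ?r 1 0 t x * ?r 0 1 t x) =
      (G 4 0 t x * G 0 0 t x - 4 * G 3 0 t x * G 1 0 t x + 3 * (G 2 0 t x)\<^sup>2 +
        3 * (G 1 1 t x * G 0 0 t x - G 1 0 t x * G 0 1 t x)) / (G 0 0 t x)\<^sup>2"
      using nz unfolding jet_def by (simp add: field_simps power2_eq_square)
    then show ?thesis by (simp only: bilinear div_0)
  qed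
  have bilinear_x: "((\<lambda>y. G 4 0 t y * G 0 0 t y - 4 * (G 3 0 t y * G 1 0 t y) + 3 * (G 2 0 t y * G 2 0 t y) +
      3 * (G 1 1 t y * G 0 0 t y - G 1 0 t y * G 0 1 t y)) has_vector_derivative
      (G 5 0 t x * G 0 0 t x - 3 * (G 4 0 t x * G 1 0 t x) + 2 * (G 3 0 t x * G 2 0 t x) +
      3 * (G 2 1 t x * G 0 0 t x - G 2 0 t x * G 0 1 t x))) (at x)"
    by (rule has_vector_derivative_eq_rhs, (rule has_vector_derivative_add has_vector_derivative_diff
      has_vector_derivative_mult has_vector_derivative_const dx)+) (simp add: eval_nat_numeral algebra_simps)
  have zero: "(\<lambda>y. G 4 0 t y * G 0 0 t y - 4 * (G 3 0 t y * G 1 0 t y) + 3 * (G 2 0 t y * G 2 0 t y) +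
      3 * (G 1 1 t y * G 0 0 t y - G 1 0 t y * G 0 1 t y)) = (\<lambda>_. 0)"
    using bilinear by (simp add: fun_eq_iff power2_eq_square mult.assoc)
  have bilinear_dx: "G 5 0 t x * G 0 0 t x - 3 * (G 4 0 t x * G 1 0 t x) + 2 * (G 3 0 t x * G 2 0 t x) +
      3 * (G 2 1 t x * G 0 0 t x - G 2 0 t x * G 0 1 t x) = 0"
    by (rule vector_derivative_unique_at[OF bilinear_x[unfolded zero] has_vector_derivative_const])
  have dB: "?r 5 0 t x - 3 * (?r 4 0 t x * ?r 1 0 t x) + 2 * (?r 3 0 t x * ?r 2 0 t x) +
      3 * (?r 2 1 t x - ?r 2 0 t x * ?r 0 1 t x) = 0"
  proof -
    have "?r 5 0 t x - 3 * (?r 4 0 t x * ?r 1 0 t x) + 2 * (?r 3 0 t x * ?r 2 0 t x) +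
        3 * (?r 2 1 t x - ?r 2 0 t x * ?r 0 1 t x) =
      (G 5 0 t x * G 0 0 t x - 3 * (G 4 0 t x * G 1 0 t x) + 2 * (G 3 0 t x * G 2 0 t x) +
        3 * (G 2 1 t x * G 0 0 t x - G 2 0 t x * G 0 1 t x)) / (G 0 0 t x)\<^sup>2"
      using nz unfolding jet_def by (simp add: field_simps power2_eq_square)
    then show ?thesis by (simp only: bilinear_dx div_0)
  qed
  \<comment> \<open>If H is the bilinear expression, the KdV expression is the x-derivative of
    2H/G^2, that is 2 H_x/G^2 - 4 r_1 H/G^2. The two premises say that H/G^2 and H_x/G^2
    vanish.\<close>
  have *: "6 * (c2 - r2 * c0) - 12 * (r1 * (c1 - r1 * c0)) +
      2 * (r5 - 5 * (r1 * r4) - 10 * (r2 * r3) + 20 * (r1 * (r1 * r3)) + 30 * (r1 * (r2 * r2)) -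
      60 * (r1 * (r1 * (r1 * r2))) + 24 * (r1 * (r1 * (r1 * (r1 * r1))))) +
      24 * ((r2 - r1 * r1) * (r3 - 3 * (r1 * r2) + 2 * (r1 * (r1 * r1)))) = 0"
    if "r4 - 4 * r3 * r1 + 3 * r2\<^sup>2 + 3 * (c1 - r1 * c0) = 0"
      "r5 - 3 * (r4 * r1) + 2 * (r3 * r2) + 3 * (c2 - r2 * c0) = 0"
    for c0 c1 c2 r1 r2 r3 r4 r5 :: complex
  proof -
    have 1: "3 * (c1 - r1 * c0) = - (r4 - 4 * r3 * r1 + 3 * r2\<^sup>2)"
      unfolding eq_neg_iff_add_eq_0 by (rule trans[OF add.commute that(1)])
    have 2: "3 * (c2 - r2 * c0) = - (r5 - 3 * (r4 * r1) + 2 * (r3 * r2))"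
      unfolding eq_neg_iff_add_eq_0 by (rule trans[OF add.commute that(2)])
    have "6 * (c2 - r2 * c0) - 12 * (r1 * (c1 - r1 * c0)) =
        2 * (3 * (c2 - r2 * c0)) - 4 * (r1 * (3 * (c1 - r1 * c0)))" by simp
    also have "\<dots> = - 2 * (r5 - 3 * (r4 * r1) + 2 * (r3 * r2)) + 4 * (r1 * (r4 - 4 * r3 * r1 + 3 * r2\<^sup>2))"
      unfolding 1 2 by (simp add: algebra_simps)
    finally show ?thesis
      by (simp add: power2_eq_square algebra_simps)
  qed
  show "3 * kdv_ut G t x + kdv_uxxx G t x + 6 * kdv_u G t x * kdv_ux G t x = 0"
    using *[OF B dB] unfolding kdv_ut_def Let_def kdv_uxxx_def Let_def kdv_u_def kdv_ux_def Let_def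
    by (simp add: algebra_simps)
qed

section \<open>Estimates on the index set\<close>

text \<open>A geometric series dominates. The bound is linear in small \<open>norm w\<close>, which
  passes Gaussian decay of the argument on to the integrand of \<open>Qfun\<close>.\<close>

lemma norm_polylog_half_le:
  assumes "norm w < 1"
  shows "norm (polylog (1/2) w) \<le> norm w / (1 - norm w)"
proof -
  have le: "norm (w ^ Suc k / of_nat (Suc k) powr (1/2)) \<le> norm w * norm w ^ k" for k
  proof -
    have "norm (complex_of_nat (Suc k) powr (1/2)) = real (Suc k) powr (1/2)"
      by (subst norm_powr_real_powr') (auto simp del: of_nat_Suc)
    moreover have "real (Suc k) powr (1/2) \<ge> 1"
      by (rule ge_one_powr_ge_zero) auto
    ultimately have "norm (w ^ Suc k / of_nat (Suc k) powr (1/2)) \<le> norm (w ^ Suc k) / 1"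
      unfolding norm_divide by (intro divide_left_mono) auto
    then show ?thesis by (simp add: norm_mult norm_power)
  qed
  have "(\<lambda>k. norm w * norm w ^ k) sums (norm w * (1 / (1 - norm w)))"
    using assms by (intro sums_mult geometric_sums) simp
  then have "norm (\<Sum>k. w ^ Suc k / of_nat (Suc k) powr (1/2)) \<le> norm w * (1 / (1 - norm w))"
    using le by (metis (no_types, lifting) norm_suminf_le sums_iff)
  then show ?thesis using assms by (simp add: polylog_def)
qed

lemma Re_minus_half_square: "Re (- w\<^sup>2 / 2) = ((Im w)\<^sup>2 - (Re w)\<^sup>2) / 2"
  by (simp add: power2_eq_square field_simps)

text \<open>Taking moduli in the defining equation puts the points on the left branch of a hyperbola
  with asymptotes at 45 degrees to the axes.\<close>

lemma S_minus_geometry: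
  assumes "\<xi> \<in> S_minus z" "0 < norm z" "norm z < 1"
  shows "(Re \<xi>)\<^sup>2 - (Im \<xi>)\<^sup>2 = - 2 * ln (norm z)" "\<bar>Im \<xi>\<bar> < - Re \<xi>" "Re \<xi> < 0"
proof -
  have e: "exp (- \<xi>\<^sup>2 / 2) = z" and neg: "Re \<xi> < 0" using assms(1) by (auto simp: S_minus_def)
  have "norm z = exp (((Im \<xi>)\<^sup>2 - (Re \<xi>)\<^sup>2) / 2)"
    using e norm_exp_eq_Re Re_minus_half_square by metis
  then have "ln (norm z) = ((Im \<xi>)\<^sup>2 - (Re \<xi>)\<^sup>2) / 2" by simp
  then show 1: "(Re \<xi>)\<^sup>2 - (Im \<xi>)\<^sup>2 = - 2 * ln (norm z)" by simp
  have "ln (norm z) < 0" using assms by simp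
  then have "(Im \<xi>)\<^sup>2 < (- Re \<xi>)\<^sup>2" using 1 by simp
  then show "\<bar>Im \<xi>\<bar> < - Re \<xi>"
    using neg by (metis abs_le_square_iff abs_of_pos neg_0_less_iff_less not_le)
  show "Re \<xi> < 0" by (rule neg)
qed

text \<open>On the ray, \<open>t\<close> and \<open>Re \<xi>\<close> are both nonpositive, so the
  argument of \<open>polylog\<close> has modulus at most |z| exp(-t^2/2). It stays in the unit disc,
  and a Gaussian independent of \<open>\<xi>\<close> dominates the integrand.\<close>

lemma Qfun_bounded:
  assumes "0 < norm z" "norm z < 1"
  obtains C where "\<And>\<xi>. \<xi> \<in> S_minus z \<Longrightarrow> norm (Qfun \<xi>) \<le> C"
proof -
  define g where "g t = indicator {..0} t * (norm z / (1 - norm z) * (sqrt (2 * pi) * std_normal_density t))" for t :: real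
  have g: "integrable lborel g"
    unfolding g_def
    by (intro integrable_mult_indicator[where f = "\<lambda>t. norm z / (1 - norm z) *
          (sqrt (2 * pi) * std_normal_density t)", unfolded real_scaleR_def]
        integrable_mult_right integrable_normal_density) auto
  show thesis
  proof (rule that)
    fix \<xi> assume \<xi>: "\<xi> \<in> S_minus z"
    note geo = S_minus_geometry[OF \<xi> assms]
    let ?f = "\<lambda>t. indicator {..0} t *\<^sub>R polylog (1/2) (exp (- (\<xi> + of_real t)\<^sup>2 / 2))"
    have le: "norm (?f t) \<le> g t" for t
    proof (cases "t \<le> 0")
      case True
      define w where "w = exp (- (\<xi> + of_real t)\<^sup>2 / 2)"
      have "Re (- (\<xi> + of_real t)\<^sup>2 / 2) = ((Im \<xi>)\<^sup>2 - (Re \<xi>)\<^sup>2) / 2 + - t * Re \<xi> + - t\<^sup>2 / 2"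
        unfolding Re_minus_half_square by (simp add: power2_sum field_simps)
      also have "((Im \<xi>)\<^sup>2 - (Re \<xi>)\<^sup>2) / 2 = ln (norm z)" using geo(1) by simp
      finally have nw: "norm w = norm z * exp (- t * Re \<xi>) * exp (- t\<^sup>2 / 2)"
        unfolding w_def norm_exp_eq_Re using assms(1) by (simp only: exp_add exp_ln)
      have "exp (- t * Re \<xi>) \<le> 1" using True geo(3) by (simp add: mult_nonpos_nonpos)
      then have le1: "norm w \<le> norm z * exp (- t\<^sup>2 / 2)"
        unfolding nw using assms(1)
        by (intro mult_right_mono mult_left_mono[where b = 1, simplified mult_1_right]) auto
      also have le2: "norm z * exp (- t\<^sup>2 / 2) \<le> norm z"
        using mult_left_mono[of "exp (- t\<^sup>2 / 2)" 1 "norm z"] by simp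
      finally have le3: "norm w \<le> norm z" .
      have "norm (polylog (1/2) w) \<le> norm w / (1 - norm w)"
        by (rule norm_polylog_half_le) (use le3 assms in simp)
      also have "\<dots> \<le> norm z * exp (- t\<^sup>2 / 2) / (1 - norm z)"
        using le1 le3 assms by (intro frac_le) auto
      also have "\<dots> = g t"
        using True by (simp add: g_def std_normal_density_def)
      finally show ?thesis using True by (simp add: w_def)
    qed (simp add: g_def)
    have "norm (integral\<^sup>L lborel ?f) \<le> integral\<^sup>L lborel g"
    proof (cases "integrable lborel ?f")
      case True
      then show ?thesis
        by (intro order_trans[OF integral_norm_bound] integral_mono[OF integrable_norm g le])
    next
      \<comment> \<open>The integral of a non-integrable function is 0 by convention, so the bound
        holds here as well.\<close>
      case False
      have "0 \<le> g t" for t by (rule order_trans[OF norm_ge_zero le])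
      then show ?thesis using False by (simp add: not_integrable_integral_eq)
    qed
    then show "norm (Qfun \<xi>) \<le> sqrt (2 / pi) * integral\<^sup>L lborel g"
      unfolding Qfun_def set_lebesgue_integral_def norm_mult
      by (intro mult_mono) auto
  qed
qed

lemma summable_on_exp_minus_abs_int: "(\<lambda>n::int. exp (- \<bar>real_of_int n\<bar>)) summable_on UNIV"
proof -
  have geo: "(\<lambda>n. exp (- real n)) summable_on (UNIV :: nat set)"
  proof (rule summable_nonneg_imp_summable_on)
    have "summable (\<lambda>n. exp (- 1 :: real) ^ n)" by (rule summable_geometric) simp
    then show "summable (\<lambda>n. exp (- real n))"
      by (simp add: exp_of_nat_mult[symmetric])
  qed simp
  have "(\<lambda>n::int. exp (- \<bar>real_of_int n\<bar>)) summable_on range int"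
    by (subst summable_on_reindex) (use geo in \<open>auto simp: o_def\<close>)
  moreover have "(\<lambda>n::int. exp (- \<bar>real_of_int n\<bar>)) summable_on ((\<lambda>n. - int n) ` {1..})"
    by (subst summable_on_reindex)
      (use summable_on_subset[OF geo, of "{1..}"] in \<open>auto simp: o_def inj_on_def\<close>)
  ultimately have "(\<lambda>n::int. exp (- \<bar>real_of_int n\<bar>)) summable_on (range int \<union> (\<lambda>n. - int n) ` {1..})"
    by (rule summable_on_Un_disjoint) auto
  moreover have "n \<in> range int \<union> (\<lambda>n. - int n) ` {1..}" for n
  proof (cases n rule: int_cases)
    case (neg m)
    then have "n = - int (Suc m)" by simp
    then show ?thesis by (intro UnI2 image_eqI[of _ _ "Suc m"]) auto
  qed auto
  ultimately show ?thesis by (metis UNIV_eq_I)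
qed

lemma cubic_decay:
  fixes e M :: real
  assumes "e > 0"
  obtains K where "\<And>a. 0 \<le> a \<Longrightarrow> M * a - e * a ^ 3 \<le> K - a\<^sup>2"
proof -
  \<comment> \<open>Beyond \<open>B\<close> the cubic exceeds (1 + |M|) a^2, hence a^2 + M a; up to
    \<open>B\<close> a constant covers everything.\<close>
  define B where "B = max 1 ((1 + \<bar>M\<bar>) / e)"
  have B: "B \<ge> 1" "B * e \<ge> 1 + \<bar>M\<bar>" using assms by (auto simp: B_def max_def field_simps)
  have "M * a - e * a ^ 3 \<le> (B\<^sup>2 + \<bar>M\<bar> * B) - a\<^sup>2" if a: "0 \<le> a" for a
  proof (cases "a \<le> B")
    case True
    then have "a\<^sup>2 \<le> B\<^sup>2" "\<bar>M\<bar> * a \<le> \<bar>M\<bar> * B"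
      using a by (auto intro: power_mono mult_left_mono)
    moreover have "M * a \<le> \<bar>M\<bar> * a" "0 \<le> e * a ^ 3" using a assms by (auto intro: mult_right_mono)
    ultimately show ?thesis by linarith
  next
    case False
    then have a1: "a \<ge> 1" "a \<ge> B" using B by auto
    have "M * a \<le> \<bar>M\<bar> * a\<^sup>2"
    proof -
      have "M * a \<le> \<bar>M\<bar> * a" using a by (intro mult_right_mono) auto
      also have "\<dots> \<le> \<bar>M\<bar> * a\<^sup>2" using a1 by (intro mult_left_mono) (auto simp: power2_eq_square)
      finally show ?thesis .
    qed
    moreover have "(1 + \<bar>M\<bar>) * a\<^sup>2 \<le> e * a ^ 3"
    proof -
      have "1 + \<bar>M\<bar> \<le> a * e" using B(2) a1 assms by (meson mult_right_mono order_trans less_imp_le)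
      then have "(1 + \<bar>M\<bar>) * a\<^sup>2 \<le> (a * e) * a\<^sup>2" by (intro mult_right_mono) auto
      then show ?thesis by (simp add: power2_eq_square power3_eq_cube mult_ac)
    qed
    moreover have "0 \<le> B\<^sup>2 + \<bar>M\<bar> * B" using B by auto
    ultimately show ?thesis by (simp add: algebra_simps)
  qed
  then show thesis by (rule that)
qed

text \<open>Points are labelled by the branch integer \<open>N\<close> of the logarithm, injectively
  because the sign of the real part selects the square root. With a = -Re \<open>\<xi>\<close> the
  label grows at most like a^2, while on the hyperbola the real part of the cube is 2a^3 minus a
  multiple of a. Cubic decay therefore beats the labels, and a two-sided geometric series
  dominates.\<close>

lemma summable_on_S_minus:
  assumes z: "0 < norm z" "norm z < 1" and "\<tau> > 0"
  shows "(\<lambda>\<xi>. exp (Re (of_real \<tau> * (- (\<xi> ^ 3 / 3)) + of_real x * \<xi>) +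
      \<tau> / 8 * (norm (\<xi> ^ 3 / 3) + norm \<xi>))) summable_on S_minus z"
proof -
  define \<rho> where "\<rho> = - 2 * ln (norm z)"
  have "\<forall>\<xi>\<in>S_minus z. \<exists>n::int. - \<xi>\<^sup>2 / 2 = Ln z + of_int (2 * n) * pi * \<i>"
  proof
    fix \<xi> assume "\<xi> \<in> S_minus z"
    then have "exp (- \<xi>\<^sup>2 / 2) = exp (Ln z)" using z by (auto simp: S_minus_def)
    then show "\<exists>n::int. - \<xi>\<^sup>2 / 2 = Ln z + of_int (2 * n) * pi * \<i>"
      by (simp only: exp_eq)
  qed
  then obtain N :: "complex \<Rightarrow> int" where
    N: "\<And>\<xi>. \<xi> \<in> S_minus z \<Longrightarrow> - \<xi>\<^sup>2 / 2 = Ln z + of_int (2 * N \<xi>) * pi * \<i>"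
    by metis
  have inj: "inj_on N (S_minus z)"
  proof (rule inj_onI)
    fix \<xi> \<eta> assume *: "\<xi> \<in> S_minus z" "\<eta> \<in> S_minus z" "N \<xi> = N \<eta>"
    then have "- \<xi>\<^sup>2 / 2 = - \<eta>\<^sup>2 / 2" using N[OF *(1)] N[OF *(2)] by (simp only:)
    then have "\<xi>\<^sup>2 = \<eta>\<^sup>2" by simp
    then have "\<xi> = \<eta> \<or> \<xi> = - \<eta>" by (simp add: power2_eq_iff)
    moreover have "Re \<xi> < 0" "Re \<eta> < 0" using *(1,2) by (simp_all add: S_minus_def)
    ultimately show "\<xi> = \<eta>" by auto
  qed
  \<comment> \<open>The linear coefficient collects \<open>\<tau> * \<rho>\<close> from the cube,
    |x| from the linear flow, and \<open>\<tau> / 4\<close> from the margin.\<close>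
  obtain K where K: "\<And>a. 0 \<le> a \<Longrightarrow> (\<tau> * \<rho> + \<bar>x\<bar> + \<tau> / 4) * a - \<tau> / 3 * a ^ 3 \<le> K - a\<^sup>2"
    using cubic_decay[of "\<tau> / 3" "\<tau> * \<rho> + \<bar>x\<bar> + \<tau> / 4"] assms(3) by auto
  have "(\<lambda>\<xi>. norm (exp (Re (of_real \<tau> * (- (\<xi> ^ 3 / 3)) + of_real x * \<xi>) +
      \<tau> / 8 * (norm (\<xi> ^ 3 / 3) + norm \<xi>)))) summable_on S_minus z"
  proof (rule Infinite_Sum.abs_summable_on_comparison_test')
    have "((\<lambda>n::int. exp (- \<bar>real_of_int n\<bar>)) \<circ> N) summable_on S_minus z"
      using summable_on_exp_minus_abs_int inj by (metis summable_on_reindex summable_on_subset subset_UNIV)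
    then show "(\<lambda>\<xi>. exp (K + 1) * exp (- \<bar>real_of_int (N \<xi>)\<bar>)) summable_on S_minus z"
      by (intro summable_on_cmult_right) (simp add: o_def)
    fix \<xi> assume \<xi>: "\<xi> \<in> S_minus z"
    note geo = S_minus_geometry[OF \<xi> z]
    define a b where "a = - Re \<xi>" and "b = Im \<xi>"
    have a: "a > 0" "\<bar>b\<bar> < a" and ab: "b\<^sup>2 = a\<^sup>2 - \<rho>" using geo by (auto simp: a_def b_def \<rho>_def)
    have "\<xi> = Complex (- a) b" by (simp add: a_def b_def)
    then have "Re (\<xi> ^ 3) = 3 * a * b\<^sup>2 - a ^ 3"
      by (simp add: power3_eq_cube power2_eq_square algebra_simps)
    then have re3: "Re (\<xi> ^ 3) = 2 * a ^ 3 - 3 * \<rho> * a"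
      unfolding ab by (simp add: power3_eq_cube power2_eq_square algebra_simps)
    have n1: "norm \<xi> \<le> 2 * a"
      using cmod_le[of \<xi>] a by (simp add: a_def b_def)
    have n3: "norm (\<xi> ^ 3 / 3) \<le> 8 / 3 * a ^ 3"
      using power_mono[OF n1 norm_ge_zero, of 3] by (simp add: norm_divide norm_power power_mult_distrib)
    have "\<bar>2 * pi * real_of_int (N \<xi>)\<bar> \<le> a\<^sup>2 + pi"
    proof -
      have "2 * pi * real_of_int (N \<xi>) = Im (- \<xi>\<^sup>2 / 2) - Im (Ln z)"
        unfolding N[OF \<xi>] by simp
      moreover have "\<bar>Im (- \<xi>\<^sup>2 / 2)\<bar> = a * \<bar>b\<bar>"
        using a by (simp add: power2_eq_square a_def b_def abs_mult)
      moreover have "a * \<bar>b\<bar> \<le> a\<^sup>2" using a by (simp add: power2_eq_square mult_left_mono)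
      moreover have "\<bar>Im (Ln z)\<bar> \<le> pi" using mpi_less_Im_Ln[of z] Im_Ln_le_pi[of z] z by auto
      ultimately show ?thesis by linarith
    qed
    then have "2 * pi * \<bar>real_of_int (N \<xi>)\<bar> \<le> a\<^sup>2 + pi" by (simp add: abs_mult)
    then have Na: "\<bar>real_of_int (N \<xi>)\<bar> \<le> a\<^sup>2 + 1"
    proof (cases "\<bar>real_of_int (N \<xi>)\<bar> \<le> 1")
      case True
      then show ?thesis by (simp add: add_increasing)
    next
      case False
      then have "pi * 1 \<le> pi * \<bar>real_of_int (N \<xi>)\<bar>" by (intro mult_left_mono) auto
      moreover have "1 * \<bar>real_of_int (N \<xi>)\<bar> \<le> pi * \<bar>real_of_int (N \<xi>)\<bar>"
        using pi_gt3 by (intro mult_right_mono) auto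
      ultimately show ?thesis
        using \<open>2 * pi * \<bar>real_of_int (N \<xi>)\<bar> \<le> a\<^sup>2 + pi\<close> by linarith
    qed
    have "Re (of_real \<tau> * (- (\<xi> ^ 3 / 3)) + of_real x * \<xi>) = - \<tau> * Re (\<xi> ^ 3) / 3 - x * a"
      by (simp add: a_def)
    also have "\<dots> = \<tau> * \<rho> * a - x * a - 2 * \<tau> / 3 * a ^ 3"
      unfolding re3 by (simp add: field_simps)
    finally have "Re (of_real \<tau> * (- (\<xi> ^ 3 / 3)) + of_real x * \<xi>) = \<tau> * \<rho> * a - x * a - 2 * \<tau> / 3 * a ^ 3" .
    \<comment> \<open>The rate \<open>\<tau> / 8\<close> is chosen so that the margin costs
      \<open>\<tau> / 3 * a ^ 3\<close>, half of the available decay.\<close>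
    moreover have "\<tau> / 8 * (norm (\<xi> ^ 3 / 3) + norm \<xi>) \<le> \<tau> / 8 * (8 / 3 * a ^ 3 + 2 * a)"
      using n1 n3 assms(3) by (intro mult_left_mono add_mono) auto
    moreover have "- x * a \<le> \<bar>x\<bar> * a" using a by (intro mult_right_mono) auto
    ultimately have "Re (of_real \<tau> * (- (\<xi> ^ 3 / 3)) + of_real x * \<xi>) +
        \<tau> / 8 * (norm (\<xi> ^ 3 / 3) + norm \<xi>) \<le> (\<tau> * \<rho> + \<bar>x\<bar> + \<tau> / 4) * a - \<tau> / 3 * a ^ 3"
      by (simp add: algebra_simps)
    also have "\<dots> \<le> K - a\<^sup>2" using K a by simp
    also have "\<dots> \<le> K + 1 + - \<bar>real_of_int (N \<xi>)\<bar>" using Na by simp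
    finally show "norm (exp (Re (of_real \<tau> * (- (\<xi> ^ 3 / 3)) + of_real x * \<xi>) +
      \<tau> / 8 * (norm (\<xi> ^ 3 / 3) + norm \<xi>))) \<le> exp (K + 1) * exp (- \<bar>real_of_int (N \<xi>)\<bar>)"
      by (simp add: exp_add[symmetric])
  qed
  then show ?thesis by simp
qed

section \<open>The Fredholm series as a sum over finite subsets\<close>

lemma card_inj_PiE_self:
  assumes "finite A"
  shows "card {\<xi> \<in> {..<card A} \<rightarrow>\<^sub>E A. inj_on \<xi> {..<card A}} = fact (card A)"
  using card_inj_on_subset_funcset[of "{..<card A}" A "{..<card A}"] assms
  by (simp add: fact_prod_rev)

text \<open>Each point collects -1 from the sign, e^2/q from scaling its row and column, and 1/(2q)
  from the Cauchy determinant. A repeated point gives two equal rows.\<close>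

lemma det_Cauchy_kernel:
  fixes e :: "complex \<Rightarrow> complex"
  assumes nz: "\<And>q r. q \<in> S \<Longrightarrow> r \<in> S \<Longrightarrow> q + r \<noteq> 0" and \<xi>: "\<xi> \<in> {..<n} \<rightarrow> S"
  shows "(-1) ^ n * Determinant.det (Matrix.mat n n (\<lambda>(i, j). e (\<xi> i) * e (\<xi> j) / (\<xi> i * (\<xi> i + \<xi> j)))) =
    (if inj_on \<xi> {..<n} then soliton_weight (\<xi> ` {..<n}) * (\<Prod>q\<in>\<xi> ` {..<n}. - (e q)\<^sup>2 / (2 * q\<^sup>2)) else 0)"
proof (cases "inj_on \<xi> {..<n}")
  case True
  have "Determinant.det (Matrix.mat n n (\<lambda>(i, j). e (\<xi> i) * e (\<xi> j) / (\<xi> i * (\<xi> i + \<xi> j)))) =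
      Determinant.det (Matrix.mat n n (\<lambda>(i, j). e (\<xi> i) / \<xi> i * e (\<xi> j) * (1 / (\<xi> i + \<xi> j))))"
    by (intro arg_cong[of _ _ Determinant.det] eq_matI) auto
  also have "\<dots> = (\<Prod>i<n. e (\<xi> i) / \<xi> i * e (\<xi> i)) * (soliton_weight (\<xi> ` {..<n}) * (\<Prod>i<n. 1 / (2 * \<xi> i)))"
    using True \<xi> nz by (subst det_scale_rows_cols, subst det_symmetric_Cauchy) (auto simp: Pi_iff)
  finally have "(-1) ^ n * Determinant.det (Matrix.mat n n (\<lambda>(i, j). e (\<xi> i) * e (\<xi> j) / (\<xi> i * (\<xi> i + \<xi> j)))) =
      soliton_weight (\<xi> ` {..<n}) * ((\<Prod>i<n. - 1) * (\<Prod>i<n. e (\<xi> i) / \<xi> i * e (\<xi> i)) * (\<Prod>i<n. 1 / (2 * \<xi> i)))"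
    by (simp add: mult_ac)
  also have "(\<Prod>i<n. - 1) * (\<Prod>i<n. e (\<xi> i) / \<xi> i * e (\<xi> i)) * (\<Prod>i<n. 1 / (2 * \<xi> i)) =
      (\<Prod>i<n. - (e (\<xi> i))\<^sup>2 / (2 * (\<xi> i)\<^sup>2))"
    unfolding prod.distrib[symmetric] by (intro prod.cong) (auto simp: power2_eq_square)
  also have "\<dots> = (\<Prod>q\<in>\<xi> ` {..<n}. - (e q)\<^sup>2 / (2 * q\<^sup>2))"
    using True by (subst prod.reindex) auto
  finally show ?thesis using True by simp
next
  case False
  then obtain i j where ij: "i < n" "j < n" "i \<noteq> j" "\<xi> i = \<xi> j" by (auto simp: inj_on_def)
  have "Determinant.det (Matrix.mat n n (\<lambda>(i, j). e (\<xi> i) * e (\<xi> j) / (\<xi> i * (\<xi> i + \<xi> j)))) = 0"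
    by (rule det_identical_rows[OF mat_carrier ij(3,1,2)]) (use ij in \<open>auto intro!: eq_vecI\<close>)
  then show ?thesis using False by simp
qed

text \<open>Injective tuples are fibred over their images; each set of \<open>n\<close> points has
  n! enumerations, which offsets the 1/n! of the Fredholm series.\<close>

lemma has_sum_injective_tuples:
  fixes T :: "'a set \<Rightarrow> complex"
  assumes "(\<lambda>A. norm (T A)) summable_on {A \<in> finite_subsets S. card A = n}"
  shows "((\<lambda>\<xi>. if inj_on \<xi> {..<n} then T (\<xi> ` {..<n}) else 0) has_sum
    (fact n * (\<Sum>\<^sub>\<infinity>A\<in>{A \<in> finite_subsets S. card A = n}. T A))) ({..<n} \<rightarrow>\<^sub>E S)"
proof -
  define P where "P = {A \<in> finite_subsets S. card A = n}"
  define J where "J = (\<lambda>A :: 'a set. {\<xi> \<in> {..<n} \<rightarrow>\<^sub>E A. inj_on \<xi> {..<n}})"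
  have cJ: "finite (J A)" "card (J A) = fact n" if "A \<in> P" for A
  proof -
    have A: "finite A" "card A = n" using that by (auto simp: P_def finite_subsets_def)
    show "finite (J A)"
      by (rule finite_subset[of _ "{..<n} \<rightarrow>\<^sub>E A"]) (auto simp: J_def A intro!: finite_PiE)
    show "card (J A) = fact n" using card_inj_PiE_self[OF A(1)] by (simp add: J_def A)
  qed
  have im: "\<xi> ` {..<n} = A" if "A \<in> P" "\<xi> \<in> J A" for A \<xi>
    using that by (intro card_subset_eq) (auto simp: P_def J_def finite_subsets_def card_image)
  have bij: "bij_betw snd (Sigma P J) {\<xi> \<in> {..<n} \<rightarrow>\<^sub>E S. inj_on \<xi> {..<n}}"
  proof (rule bij_betw_byWitness[where f' = "\<lambda>\<xi>. (\<xi> ` {..<n}, \<xi>)"])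
    show "(\<lambda>\<xi>. (\<xi> ` {..<n}, \<xi>)) ` {\<xi> \<in> {..<n} \<rightarrow>\<^sub>E S. inj_on \<xi> {..<n}} \<subseteq> Sigma P J"
      by (auto simp: P_def J_def finite_subsets_def card_image PiE_iff)
    show "snd ` Sigma P J \<subseteq> {\<xi> \<in> {..<n} \<rightarrow>\<^sub>E S. inj_on \<xi> {..<n}}"
      by (auto simp: P_def J_def finite_subsets_def PiE_iff)
  qed (use im in auto)
  have hs: "((\<lambda>p. T (snd p ` {..<n})) has_sum (fact n * infsum T P)) (Sigma P J)"
  proof (rule has_sum_SigmaI)
    fix A assume A: "A \<in> P"
    have "(\<Sum>\<xi>\<in>J A. T (\<xi> ` {..<n})) = fact n * T A"
      using im[OF A] cJ[OF A] by (simp cong: sum.cong)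
    then show "((\<lambda>\<xi>. T (snd (A, \<xi>) ` {..<n})) has_sum (fact n * T A)) (J A)"
      using has_sum_finite[OF cJ(1)[OF A], of "\<lambda>\<xi>. T (\<xi> ` {..<n})"] by simp
  next
    show "((\<lambda>A. fact n * T A) has_sum (fact n * infsum T P)) P"
      using assms unfolding P_def[symmetric]
      by (rule has_sum_cmult_right[OF has_sum_infsum[OF abs_summable_summable]])
    have "(\<lambda>p. norm (T (snd p ` {..<n}))) summable_on Sigma P J"
    proof (rule summable_on_SigmaI)
      fix A assume A: "A \<in> P"
      have "(\<Sum>\<xi>\<in>J A. norm (T (\<xi> ` {..<n}))) = fact n * norm (T A)"
        using im[OF A] cJ[OF A] by (simp cong: sum.cong)
      then show "((\<lambda>\<xi>. norm (T (snd (A, \<xi>) ` {..<n}))) has_sum (fact n * norm (T A))) (J A)"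
        using has_sum_finite[OF cJ(1)[OF A], of "\<lambda>\<xi>. norm (T (\<xi> ` {..<n}))"] by simp
    next
      show "(\<lambda>A. fact n * norm (T A)) summable_on P"
        using assms unfolding P_def[symmetric] by (rule summable_on_cmult_right)
    qed (rule norm_ge_zero)
    then show "(\<lambda>p. T (snd p ` {..<n})) summable_on Sigma P J"
      by (rule abs_summable_summable)
  qed
  have "((\<lambda>\<xi>. T (\<xi> ` {..<n})) has_sum (fact n * infsum T P)) {\<xi> \<in> {..<n} \<rightarrow>\<^sub>E S. inj_on \<xi> {..<n}}"
    using hs has_sum_reindex_bij_betw[OF bij, of "\<lambda>\<xi>. T (\<xi> ` {..<n})"] by simp
  also have "?this \<longleftrightarrow> ((\<lambda>\<xi>. if inj_on \<xi> {..<n} then T (\<xi> ` {..<n}) else 0) has_sum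
      (fact n * infsum T P)) ({..<n} \<rightarrow>\<^sub>E S)"
    by (intro has_sum_cong_neutral) auto
  finally show ?thesis by (simp add: P_def)
qed

lemma fredholm_det_Cauchy_kernel:
  fixes e :: "complex \<Rightarrow> complex"
  defines "T \<equiv> \<lambda>A. soliton_weight A * (\<Prod>q\<in>A. - (e q)\<^sup>2 / (2 * q\<^sup>2))"
  assumes nz: "\<And>q r. q \<in> S \<Longrightarrow> r \<in> S \<Longrightarrow> q + r \<noteq> 0"
    and summ: "(\<lambda>A. norm (T A)) summable_on finite_subsets S"
  shows "fredholm_det S (\<lambda>q r. e q * e r / (q * (q + r))) = (\<Sum>\<^sub>\<infinity>A\<in>finite_subsets S. T A)"
proof -
  define P where "P n = {A \<in> finite_subsets S. card A = n}" for n
  have sP: "(\<lambda>A. norm (T A)) summable_on P n" for n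
    by (rule summable_on_subset[OF summ]) (auto simp: P_def)
  have "(-1) ^ n / fact n * (\<Sum>\<^sub>\<infinity>\<xi>\<in>({..<n} \<rightarrow>\<^sub>E S).
      Determinant.det (Matrix.mat n n (\<lambda>(i, j). e (\<xi> i) * e (\<xi> j) / (\<xi> i * (\<xi> i + \<xi> j))))) = infsum T (P n)" for n
  proof -
    have "(-1) ^ n * (\<Sum>\<^sub>\<infinity>\<xi>\<in>({..<n} \<rightarrow>\<^sub>E S).
        Determinant.det (Matrix.mat n n (\<lambda>(i, j). e (\<xi> i) * e (\<xi> j) / (\<xi> i * (\<xi> i + \<xi> j))))) =
      (\<Sum>\<^sub>\<infinity>\<xi>\<in>({..<n} \<rightarrow>\<^sub>E S). (-1) ^ n *
        Determinant.det (Matrix.mat n n (\<lambda>(i, j). e (\<xi> i) * e (\<xi> j) / (\<xi> i * (\<xi> i + \<xi> j)))))"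
      by (rule infsum_cmult_right'[symmetric])
    also have "\<dots> = (\<Sum>\<^sub>\<infinity>\<xi>\<in>({..<n} \<rightarrow>\<^sub>E S). if inj_on \<xi> {..<n} then T (\<xi> ` {..<n}) else 0)"
      unfolding T_def by (intro infsum_cong det_Cauchy_kernel[OF nz]) (auto simp: PiE_iff)
    also have "\<dots> = fact n * infsum T (P n)"
      using has_sum_injective_tuples[OF sP[unfolded P_def]] unfolding P_def by (rule infsumI)
    finally show ?thesis by (simp add: field_simps)
  qed
  then have "fredholm_det S (\<lambda>q r. e q * e r / (q * (q + r))) = (\<Sum>n. infsum T (P n))"
    by (simp add: fredholm_det_def)
  moreover have "((\<lambda>n. infsum T (P n)) has_sum infsum T (finite_subsets S)) UNIV"
  proof (rule has_sum_SigmaD)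
    have bij: "bij_betw snd (Sigma UNIV P) (finite_subsets S)"
      by (rule bij_betw_byWitness[where f' = "\<lambda>A. (card A, A)"]) (auto simp: P_def)
    show "((\<lambda>p. T (snd p)) has_sum infsum T (finite_subsets S)) (Sigma UNIV P)"
      using has_sum_reindex_bij_betw[OF bij, of T] has_sum_infsum[OF abs_summable_summable[OF summ]] by blast
    show "((\<lambda>A. T (snd (n, A))) has_sum infsum T (P n)) (P n)" for n
      unfolding snd_conv by (rule has_sum_infsum[OF abs_summable_summable[OF sP]])
  qed
  then have "(\<lambda>n. infsum T (P n)) sums infsum T (finite_subsets S)"
    by (rule has_sum_imp_sums)
  ultimately show ?thesis by (simp add: sums_iff)
qed

section \<open>The flat determinant\<close>

lemma norm_soliton_weight_le_1:
  assumes "\<And>q r. q \<in> A \<Longrightarrow> r \<in> A \<Longrightarrow> norm (q - r) \<le> norm (q + r)"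
  shows "norm (soliton_weight A) \<le> 1"
  unfolding soliton_weight_def prod_norm[symmetric]
proof (intro prod_le_1 conjI prod_nonneg norm_ge_zero)
  fix q r assume "q \<in> A" "r \<in> A - {q}"
  then have "norm (q - r) \<le> norm (q + r)" using assms by auto
  then show "norm (\<i> * (q - r) / (q + r)) \<le> 1"
    by (cases "q + r = 0") (simp_all add: norm_divide norm_mult)
qed

text \<open>|q+r|^2 - |q-r|^2 is four times the scalar product of q and r as plane vectors, which is
  nonnegative because their directions differ by at most a right angle.\<close>

lemma S_minus_norm_diff_le:
  assumes "q \<in> S_minus z" "r \<in> S_minus z" "0 < norm z" "norm z < 1"
  shows "norm (q - r) \<le> norm (q + r)"
proof -
  note q = S_minus_geometry[OF assms(1,3,4)] and r = S_minus_geometry[OF assms(2-4)]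
  have "\<bar>Im q\<bar> * \<bar>Im r\<bar> \<le> (- Re q) * (- Re r)"
    using q(2) r(2) by (intro mult_mono) auto
  then have "0 \<le> Re q * Re r + Im q * Im r"
    by (simp add: abs_mult[symmetric])
  then have "(norm (q - r))\<^sup>2 \<le> (norm (q + r))\<^sup>2"
    unfolding cmod_power2 by (simp add: power2_eq_square algebra_simps)
  then show ?thesis by (rule power2_le_imp_le) simp
qed

lemma S_minus_add_nonzero:
  assumes "q \<in> S_minus z" "r \<in> S_minus z"
  shows "q + r \<noteq> 0"
proof
  assume "q + r = 0"
  then have "Re q + Re r = 0" by (metis plus_complex.sel(1) zero_complex.sel(1))
  then show False using assms by (auto simp: S_minus_def)
qed

lemma exp_series_partial_derivatives:
  assumes "exp_summable_at I a b c (t, x)"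
  shows "((\<lambda>s. exp_series I a b c (s, x)) has_vector_derivative
      exp_series I a b (\<lambda>i. a i * c i) (t, x)) (at t)"
    and "((\<lambda>y. exp_series I a b c (t, y)) has_vector_derivative
      exp_series I a b (\<lambda>i. b i * c i) (t, x)) (at x)"
proof -
  note d = has_derivative_exp_series[OF assms]
  have "((\<lambda>s. (s, x)) has_derivative (\<lambda>h. (h, 0))) (at t)"
    by (auto intro!: derivative_eq_intros)
  from has_derivative_compose[OF this d]
  show "((\<lambda>s. exp_series I a b c (s, x)) has_vector_derivative
      exp_series I a b (\<lambda>i. a i * c i) (t, x)) (at t)"
    by (simp add: has_vector_derivative_def scaleR_conv_of_real)
  have "((\<lambda>y. (t, y)) has_derivative (\<lambda>h. (0, h))) (at x)"
    by (auto intro!: derivative_eq_intros)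
  from has_derivative_compose[OF this d]
  show "((\<lambda>y. exp_series I a b c (t, y)) has_vector_derivative
      exp_series I a b (\<lambda>i. b i * c i) (t, x)) (at x)"
    by (simp add: has_vector_derivative_def scaleR_conv_of_real)
qed

definition soliton_coeff :: "complex \<Rightarrow> complex" where
  "soliton_coeff q = - exp (- Qfun q) / (2 * q\<^sup>2)"

definition soliton_term :: "complex set \<Rightarrow> complex" where
  "soliton_term A = soliton_weight A * (\<Prod>q\<in>A. soliton_coeff q)"

text \<open>\<open>flow_t\<close> and \<open>flow_x\<close> are the rates of the exponent of
  \<open>A\<close> in the two variables: multiplying the coefficients by one of them differentiates
  the series in the corresponding variable.\<close>

definition flow_t :: "complex set \<Rightarrow> complex" where
  "flow_t A = (\<Sum>q\<in>A. - (q ^ 3 / 3))"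

definition flow_x :: "complex set \<Rightarrow> complex" where
  "flow_x A = (\<Sum>q\<in>A. q)"

definition flat_moment :: "complex \<Rightarrow> nat \<Rightarrow> nat \<Rightarrow> real \<Rightarrow> real \<Rightarrow> complex" where
  "flat_moment z k l \<tau> x = exp_series (finite_subsets (S_minus z)) flow_t flow_x
     (\<lambda>A. flow_x A ^ k * flow_t A ^ l * soliton_term A) (\<tau>, x)"

lemma soliton_term_exp:
  assumes "finite A"
  shows "soliton_term A * exp (of_real \<tau> * flow_t A + of_real x * flow_x A) =
    soliton_weight A * (\<Prod>q\<in>A. soliton_coeff q * exp (of_real \<tau> * - (q ^ 3 / 3) + of_real x * q))"
proof -
  have "exp (of_real \<tau> * flow_t A + of_real x * flow_x A) =
      (\<Prod>q\<in>A. exp (of_real \<tau> * - (q ^ 3 / 3) + of_real x * q))"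
    unfolding flow_t_def flow_x_def sum_distrib_left sum.distrib[symmetric] by (rule exp_sum[OF assms])
  then show ?thesis by (simp only: soliton_term_def prod.distrib mult.assoc)
qed

context
  fixes z :: complex
  assumes z: "0 < norm z" "norm z < 1"
begin

lemma soliton_coeff_bounded:
  obtains C where "C \<ge> 0" "\<And>q. q \<in> S_minus z \<Longrightarrow> norm (soliton_coeff q) \<le> C"
proof -
  obtain B where B: "\<And>q. q \<in> S_minus z \<Longrightarrow> norm (Qfun q) \<le> B" using Qfun_bounded[OF z] by blast
  define \<rho> where "\<rho> = - 2 * ln (norm z)"
  have \<rho>: "\<rho> > 0" using z by (simp add: \<rho>_def)
  show thesis
  proof (rule that)
    show "0 \<le> exp B / (2 * \<rho>)" using \<rho> by simp
    fix q assume q: "q \<in> S_minus z"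
    have "norm (exp (- Qfun q)) \<le> exp B"
      using norm_exp[of "- Qfun q"] B[OF q] by (simp add: order_trans)
    moreover have "\<rho> \<le> (norm q)\<^sup>2"
      using S_minus_geometry(1)[OF q z] unfolding cmod_power2 \<rho>_def[symmetric]
      by (smt (verit) zero_le_power2)
    ultimately show "norm (soliton_coeff q) \<le> exp B / (2 * \<rho>)"
      unfolding soliton_coeff_def norm_divide norm_mult norm_minus_cancel norm_power
      using \<rho> by (intro frac_le) auto
  qed
qed

text \<open>Since the weight has modulus at most 1 and the flows are additive over \<open>A\<close>,
  each term including its margin is bounded by a product over the points of \<open>A\<close>.
  Summability over single points then suffices.\<close>

lemma exp_summable_soliton_term:
  assumes "\<tau> > 0"
  shows "exp_summable_at (finite_subsets (S_minus z)) flow_t flow_x soliton_term (\<tau>, x)"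
proof -
  obtain C where C: "C \<ge> 0" "\<And>q. q \<in> S_minus z \<Longrightarrow> norm (soliton_coeff q) \<le> C"
    using soliton_coeff_bounded by blast
  define w where "w q = C * exp (Re (of_real \<tau> * - (q ^ 3 / 3) + of_real x * q) +
      \<tau> / 8 * (norm (q ^ 3 / 3) + norm q))" for q
  have w: "w summable_on S_minus z"
    unfolding w_def by (intro summable_on_cmult_right summable_on_S_minus z assms)
  have w0: "w q \<ge> 0" for q unfolding w_def using C by simp
  have "(\<lambda>A. norm (norm (soliton_term A * exp (of_real \<tau> * flow_t A + of_real x * flow_x A)) *
      exp (\<tau> / 8 * (norm (flow_t A) + norm (flow_x A))))) summable_on finite_subsets (S_minus z)"
  proof (rule Infinite_Sum.abs_summable_on_comparison_test')
    show "(\<lambda>A. \<Prod>q\<in>A. w q) summable_on finite_subsets (S_minus z)"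
      unfolding finite_subsets_def by (rule summable_on_prod_finite_subsets[OF w w0])
    fix A assume "A \<in> finite_subsets (S_minus z)"
    then have A: "finite A" "\<And>q. q \<in> A \<Longrightarrow> q \<in> S_minus z" by (auto simp: finite_subsets_def)
    have "norm (soliton_weight A) \<le> 1"
      by (rule norm_soliton_weight_le_1) (use S_minus_norm_diff_le A z in blast)
    then have "norm (soliton_term A * exp (of_real \<tau> * flow_t A + of_real x * flow_x A)) \<le>
        1 * (\<Prod>q\<in>A. C * exp (Re (of_real \<tau> * - (q ^ 3 / 3) + of_real x * q)))"
      unfolding soliton_term_exp[OF A(1)] norm_mult prod_norm[symmetric] norm_exp_eq_Re
      using A C by (intro mult_mono prod_mono conjI mult_right_mono) (auto intro: prod_nonneg)
    moreover have "exp (\<tau> / 8 * (norm (flow_t A) + norm (flow_x A))) \<le>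
        (\<Prod>q\<in>A. exp (\<tau> / 8 * (norm (q ^ 3 / 3) + norm q)))"
    proof -
      have "norm (flow_t A) + norm (flow_x A) \<le> (\<Sum>q\<in>A. norm (q ^ 3 / 3)) + (\<Sum>q\<in>A. norm q)"
        unfolding flow_t_def flow_x_def
        by (intro add_mono order_trans[OF norm_sum] sum_mono) auto
      then have "\<tau> / 8 * (norm (flow_t A) + norm (flow_x A)) \<le> (\<Sum>q\<in>A. \<tau> / 8 * (norm (q ^ 3 / 3) + norm q))"
        unfolding sum_distrib_left[symmetric] sum.distrib using assms by (intro mult_left_mono) auto
      then show ?thesis unfolding exp_sum[OF A(1), symmetric] by simp
    qed
    ultimately have "norm (soliton_term A * exp (of_real \<tau> * flow_t A + of_real x * flow_x A)) *
        exp (\<tau> / 8 * (norm (flow_t A) + norm (flow_x A))) \<le>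
        1 * (\<Prod>q\<in>A. C * exp (Re (of_real \<tau> * - (q ^ 3 / 3) + of_real x * q))) *
        (\<Prod>q\<in>A. exp (\<tau> / 8 * (norm (q ^ 3 / 3) + norm q)))"
      using C by (intro mult_mono) (auto intro: prod_nonneg)
    also have "\<dots> = (\<Prod>q\<in>A. w q)"
      unfolding w_def exp_add mult_1_left prod.distrib[symmetric] by (simp only: mult.assoc)
    finally show "norm (norm (soliton_term A * exp (of_real \<tau> * flow_t A + of_real x * flow_x A)) *
      exp (\<tau> / 8 * (norm (flow_t A) + norm (flow_x A)))) \<le> (\<Prod>q\<in>A. w q)"
      by simp
  qed
  then show ?thesis
    unfolding exp_summable_at_def using assms by (intro exI[of _ "\<tau> / 8"]) simp
qed

lemma exp_summable_moment:
  assumes "\<tau> > 0"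
  shows "exp_summable_at (finite_subsets (S_minus z)) flow_t flow_x
    (\<lambda>A. flow_x A ^ k * flow_t A ^ l * soliton_term A) (\<tau>, x)"
proof (induction k)
  case 0
  show ?case
  proof (induction l)
    case 0
    show ?case using exp_summable_soliton_term[OF assms] by simp
  next
    case (Suc l)
    show ?case using exp_summable_at_mult[OF Suc, of flow_t] by (simp add: mult.assoc)
  qed
next
  case (Suc k)
  show ?case using exp_summable_at_mult[OF Suc, of flow_x] by (simp add: mult.assoc)
qed

lemma flat_moment_derivatives:
  assumes "\<tau> > 0"
  shows "(flat_moment z k l \<tau> has_vector_derivative flat_moment z (Suc k) l \<tau> x) (at x)"
    and "((\<lambda>t. flat_moment z k l t x) has_vector_derivative flat_moment z k (Suc l) \<tau> x) (at \<tau>)"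
  using exp_series_partial_derivatives[OF exp_summable_moment[OF assms, of k l x]]
  unfolding flat_moment_def by (simp_all add: mult_ac)

lemma continuous_on_flat_moment:
  "continuous_on ({0<..} \<times> UNIV) (\<lambda>(\<tau>, x). flat_moment z k l \<tau> x)"
proof (intro continuous_at_imp_continuous_on ballI)
  fix p :: "real \<times> real" assume "p \<in> {0<..} \<times> UNIV"
  then have "fst p > 0" by auto
  from exp_summable_moment[OF this, of k l "snd p"]
  show "isCont (\<lambda>(\<tau>, x). flat_moment z k l \<tau> x) p"
    unfolding flat_moment_def case_prod_unfold prod.collapse
    by (rule has_derivative_continuous[OF has_derivative_exp_series])
qed

lemma flat_moment_bilinear:
  fixes \<tau> x :: real
  assumes "\<tau> > 0"
  defines "G \<equiv> \<lambda>k l. flat_moment z k l \<tau> x"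
  shows "G 4 0 * G 0 0 - 4 * G 3 0 * G 1 0 + 3 * (G 2 0)\<^sup>2 + 3 * (G 1 1 * G 0 0 - G 1 0 * G 0 1) = 0"
proof -
  define v where "v q = soliton_coeff q * exp (of_real \<tau> * - (q ^ 3 / 3) + of_real x * q)" for q
  define M where "M k l A = soliton_weight A * (\<Prod>q\<in>A. v q) * (\<Sum>q\<in>A. q) ^ k * (\<Sum>q\<in>A. q ^ 3) ^ l" for k l A
  define G' where "G' k l = (\<Sum>\<^sub>\<infinity>A\<in>finite_subsets (S_minus z). M k l A)" for k l
  have M: "M k l A = (-3) ^ l * (flow_x A ^ k * flow_t A ^ l * soliton_term A *
      exp (of_real \<tau> * flow_t A + of_real x * flow_x A))" if "A \<in> finite_subsets (S_minus z)" for k l A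
  proof -
    have "soliton_weight A * (\<Prod>q\<in>A. v q) =
        soliton_term A * exp (of_real \<tau> * flow_t A + of_real x * flow_x A)"
      unfolding v_def by (rule soliton_term_exp[symmetric]) (use that in \<open>simp add: finite_subsets_def\<close>)
    moreover have "(\<Sum>q\<in>A. q ^ 3) = -3 * flow_t A"
      by (simp add: flow_t_def sum_distrib_left sum_negf)
    ultimately show ?thesis
      by (simp only: M_def flow_x_def[symmetric] power_mult_distrib mult_ac)
  qed
  have summ: "(\<lambda>A. norm (M k l A)) summable_on finite_subsets (S_minus z)" for k l
  proof -
    have "(\<lambda>A. 3 ^ l * norm (flow_x A ^ k * flow_t A ^ l * soliton_term A *
      exp (of_real \<tau> * flow_t A + of_real x * flow_x A))) summable_on finite_subsets (S_minus z)"
      using exp_summable_at_abs_summable[OF exp_summable_moment[OF assms(1), of k l x]]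
      by (intro summable_on_cmult_right) simp
    then show ?thesis
      by (rule summable_on_cong[THEN iffD1, rotated]) (simp add: M norm_mult norm_power)
  qed
  have "G' 4 0 * G' 0 0 - 4 * G' 3 0 * G' 1 0 + 3 * (G' 2 0)\<^sup>2 = G' 1 1 * G' 0 0 - G' 1 0 * G' 0 1"
    unfolding G'_def M_def by (rule soliton_moments_bilinear[OF S_minus_add_nonzero summ[unfolded M_def]])
  \<comment> \<open>\<open>flow_t\<close> carries the factor -1/3 that the sums of cubes lack. Each
    mixed product has total order one in the cubes, so the rescaling yields the coefficient 3 of D_x
    D_tau.\<close>
  moreover have "G' k l = (-3) ^ l * G k l" for k l
    unfolding G_def flat_moment_def exp_series_def G'_def fst_conv snd_conv infsum_cmult_right'[symmetric]
    by (rule infsum_cong[OF M])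
  ultimately show ?thesis by (simp add: algebra_simps)
qed

text \<open>The minors contain exp(2 Psi) for each point. Doubling undoes the halving of x and tau
  and turns Q/2 into Q, which leaves the flow exponent and the constant
  \<open>soliton_coeff\<close>.\<close>

lemma flat_det_eq_moment:
  assumes "\<tau> > 0"
  shows "flat_det z \<tau> x = flat_moment z 0 0 \<tau> x"
proof -
  define e where "e q = exp (Psi q (x / 2) (\<tau> / 2))" for q
  have w: "- (e q)\<^sup>2 / (2 * q\<^sup>2) = soliton_coeff q * exp (of_real \<tau> * - (q ^ 3 / 3) + of_real x * q)" for q
  proof -
    have "(e q)\<^sup>2 = exp (2 * Psi q (x / 2) (\<tau> / 2))"
      by (simp add: e_def exp_double)
    also have "2 * Psi q (x / 2) (\<tau> / 2) = - Qfun q + (of_real \<tau> * - (q ^ 3 / 3) + of_real x * q)"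
      by (simp add: Psi_def field_simps)
    finally have "(e q)\<^sup>2 = exp (- Qfun q) * exp (of_real \<tau> * - (q ^ 3 / 3) + of_real x * q)"
      by (simp only: exp_add)
    then show ?thesis unfolding soliton_coeff_def by simp
  qed
  have T: "soliton_weight A * (\<Prod>q\<in>A. - (e q)\<^sup>2 / (2 * q\<^sup>2)) =
      soliton_term A * exp (of_real \<tau> * flow_t A + of_real x * flow_x A)"
    if "A \<in> finite_subsets (S_minus z)" for A
    unfolding w by (rule soliton_term_exp[symmetric]) (use that in \<open>simp add: finite_subsets_def\<close>)
  have "K1 (x / 2) (\<tau> / 2) = (\<lambda>q r. e q * e r / (q * (q + r)))"
    by (simp add: K1_def e_def exp_add fun_eq_iff)
  then have "flat_det z \<tau> x = fredholm_det (S_minus z) (\<lambda>q r. e q * e r / (q * (q + r)))"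
    by (simp only: flat_det_def)
  also have "\<dots> = (\<Sum>\<^sub>\<infinity>A\<in>finite_subsets (S_minus z). soliton_weight A * (\<Prod>q\<in>A. - (e q)\<^sup>2 / (2 * q\<^sup>2)))"
  proof (rule fredholm_det_Cauchy_kernel[OF S_minus_add_nonzero])
    have "(\<lambda>A. norm (soliton_term A * exp (of_real \<tau> * flow_t A + of_real x * flow_x A)))
        summable_on finite_subsets (S_minus z)"
      using exp_summable_at_abs_summable[OF exp_summable_soliton_term[OF assms]] by simp
    then show "(\<lambda>A. norm (soliton_weight A * (\<Prod>q\<in>A. - (e q)\<^sup>2 / (2 * q\<^sup>2)))) summable_on finite_subsets (S_minus z)"
      by (rule summable_on_cong[THEN iffD1, rotated]) (simp only: T)
  qed
  also have "\<dots> = flat_moment z 0 0 \<tau> x"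
    unfolding flat_moment_def exp_series_def fst_conv snd_conv power_0 mult_1_left
    by (rule infsum_cong[OF T])
  finally show ?thesis .
qed

lemma open_flat_domain: "open (flat_domain z)"
proof -
  have "flat_domain z = ({0<..} \<times> UNIV) \<inter> (\<lambda>(\<tau>, x). flat_moment z 0 0 \<tau> x) -` (- {0})"
    by (auto simp: flat_domain_def flat_det_eq_moment)
  also have "open \<dots>"
    by (intro continuous_open_preimage continuous_on_flat_moment open_Times) auto
  finally show ?thesis .
qed

lemma log_flat_det_near_derivatives:
  assumes "(\<tau>, x) \<in> flat_domain z"
  shows "twice_differentiable_at (log_flat_det_near z \<tau> x) x"
    and "U_flat z \<tau> x = kdv_u (flat_moment z) \<tau> x"
proof -
  have \<tau>: "\<tau> > 0" and nz: "flat_moment z 0 0 \<tau> x \<noteq> 0"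
    using assms by (auto simp: flat_domain_def flat_det_eq_moment)
  have eq: "log_flat_det_near z \<tau> x = (\<lambda>y. log_near (flat_moment z 0 0 \<tau> x) (flat_moment z 0 0 \<tau> y))"
    by (simp add: log_flat_det_near_def flat_det_eq_moment[OF \<tau>] fun_eq_iff)
  note * = log_near_second_derivative[where f = "flat_moment z 0 0 \<tau>",
      OF flat_moment_derivatives(1)[OF \<tau>] flat_moment_derivatives(1)[OF \<tau>] nz]
  show "twice_differentiable_at (log_flat_det_near z \<tau> x) x"
    unfolding eq by (rule *(1))
  show "U_flat z \<tau> x = kdv_u (flat_moment z) \<tau> x"
    unfolding U_flat_def eq *(2) by (simp add: kdv_u_def jet_def power2_eq_square numeral_2_eq_2)
qed

end

theorem corollary8p5:
  fixes z :: complex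
  assumes "0 < norm z" and "norm z < 1"
  shows "open (flat_domain z) \<and>
    (\<forall>(\<tau>, x)\<in>flat_domain z. twice_differentiable_at (log_flat_det_near z \<tau> x) x) \<and>
    (\<exists>U\<^sub>\<tau> U\<^sub>x U\<^sub>x\<^sub>x U\<^sub>x\<^sub>x\<^sub>x :: real \<Rightarrow> real \<Rightarrow> complex. \<forall>(\<tau>, x)\<in>flat_domain z.
       ((\<lambda>t. U_flat z t x) has_vector_derivative U\<^sub>\<tau> \<tau> x) (at \<tau>) \<and>
       (U_flat z \<tau> has_vector_derivative U\<^sub>x \<tau> x) (at x) \<and>
       (U\<^sub>x \<tau> has_vector_derivative U\<^sub>x\<^sub>x \<tau> x) (at x) \<and>
       (U\<^sub>x\<^sub>x \<tau> has_vector_derivative U\<^sub>x\<^sub>x\<^sub>x \<tau> x) (at x) \<and>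
       3 * U\<^sub>\<tau> \<tau> x + U\<^sub>x\<^sub>x\<^sub>x \<tau> x + 6 * U_flat z \<tau> x * U\<^sub>x \<tau> x = 0)"
proof (intro conjI)
  show "open (flat_domain z)" by (rule open_flat_domain[OF assms])
  show "\<forall>(\<tau>, x)\<in>flat_domain z. twice_differentiable_at (log_flat_det_near z \<tau> x) x"
    using log_flat_det_near_derivatives(1)[OF assms] by auto
  show "\<exists>U\<^sub>\<tau> U\<^sub>x U\<^sub>x\<^sub>x U\<^sub>x\<^sub>x\<^sub>x :: real \<Rightarrow> real \<Rightarrow> complex. \<forall>(\<tau>, x)\<in>flat_domain z.
       ((\<lambda>t. U_flat z t x) has_vector_derivative U\<^sub>\<tau> \<tau> x) (at \<tau>) \<and>
       (U_flat z \<tau> has_vector_derivative U\<^sub>x \<tau> x) (at x) \<and>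
       (U\<^sub>x \<tau> has_vector_derivative U\<^sub>x\<^sub>x \<tau> x) (at x) \<and>
       (U\<^sub>x\<^sub>x \<tau> has_vector_derivative U\<^sub>x\<^sub>x\<^sub>x \<tau> x) (at x) \<and>
       3 * U\<^sub>\<tau> \<tau> x + U\<^sub>x\<^sub>x\<^sub>x \<tau> x + 6 * U_flat z \<tau> x * U\<^sub>x \<tau> x = 0"
  proof (rule exI[of _ "kdv_ut (flat_moment z)"], rule exI[of _ "kdv_ux (flat_moment z)"],
      rule exI[of _ "kdv_uxx (flat_moment z)"], rule exI[of _ "kdv_uxxx (flat_moment z)"], clarify)
    fix \<tau> x assume dom: "(\<tau>, x) \<in> flat_domain z"
    then have \<tau>: "\<tau> > 0" and nz: "flat_moment z 0 0 \<tau> x \<noteq> 0"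
      by (auto simp: flat_domain_def flat_det_eq_moment[OF assms])
    note KdV = KdV_of_Hirota[where G = "flat_moment z", OF flat_moment_derivatives(1)[OF assms \<tau>]
        flat_moment_derivatives(2)[OF assms \<tau>] flat_moment_bilinear[OF assms \<tau>] nz]
    note U = log_flat_det_near_derivatives(2)[OF assms, symmetric]
    \<comment> \<open>\<open>U_flat\<close> is known to equal \<open>kdv_u\<close> only on the
      domain. Openness of its slices lets the first derivatives be transferred; the higher ones
      concern the explicit witnesses directly.\<close>
    have "open ((\<lambda>t. (t, x)) -` flat_domain z)" "open ((\<lambda>y. (\<tau>, y)) -` flat_domain z)"
      by (intro open_vimage open_flat_domain[OF assms] continuous_intros)+
    then have "((\<lambda>t. U_flat z t x) has_vector_derivative kdv_ut (flat_moment z) \<tau> x) (at \<tau>)"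
      and "(U_flat z \<tau> has_vector_derivative kdv_ux (flat_moment z) \<tau> x) (at x)"
      using dom by (auto intro: has_vector_derivative_transform_within_open[OF KdV(1) _ _ U]
        has_vector_derivative_transform_within_open[OF KdV(2) _ _ U])
    then show "((\<lambda>t. U_flat z t x) has_vector_derivative kdv_ut (flat_moment z) \<tau> x) (at \<tau>) \<and>
       (U_flat z \<tau> has_vector_derivative kdv_ux (flat_moment z) \<tau> x) (at x) \<and>
       (kdv_ux (flat_moment z) \<tau> has_vector_derivative kdv_uxx (flat_moment z) \<tau> x) (at x) \<and>
       (kdv_uxx (flat_moment z) \<tau> has_vector_derivative kdv_uxxx (flat_moment z) \<tau> x) (at x) \<and>
       3 * kdv_ut (flat_moment z) \<tau> x + kdv_uxxx (flat_moment z) \<tau> x +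
         6 * U_flat z \<tau> x * kdv_ux (flat_moment z) \<tau> x = 0"
      using KdV(3-5) by (simp add: U[OF dom, symmetric])
  qed
qed

end
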